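(* Fix $\alpha \in (0,1)$ and let $f_r, f_s$ be functions with $f_r(n) = o(n)$ and $f_s(n) = o(n)$, such that $r(n) = \alpha n + f_r(n)$ and $s(n) = \alpha^2 n + f_s(n)$ are nonnegative integers for all $n$. Then, as $n \to \infty$, $$ \lambda\left(G\left(n,\alpha n + f_r(n), \alpha^2n + f_s(n)\right)\right) = O\left(\frac{\max\{1, |f_s(n) - 2\alpha f_r(n)|, f_r^2(n)/n\}}{n}\, d\left(G\left(n,\alpha n + f_r(n), \alpha^2n + f_s(n)\right)\right)\right). $$
   Context: For integers $n, r, s$, the Johnson graph $G(n,r,s)$ has as vertices all vectors $v \in \{0,1\}^n$ with $\|v\|^2 = r$ (i.e. exactly $r$ coordinates equal to $1$), and two vertices are adjacent if and only if the inner product of the corresponding vectors equals $s$. This graph is regular; $d(G)$ denotes the common degree of a regular graph $G$. For a $d$-regular graph $G$ on $N$ vertices with adjacency-matrix eigenvalues $\lambda_1 \ge \lambda_2 \ge \dots \ge \lambda_N$, define $\lambda(G) = \max\{\lambda_2, -\lambda_N\} = \max\{|\lambda_2|,\dots,|\lambda_N|\}$. *)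

theory Defs
  imports
    "HOL-Library.Landau_Symbols"
    "Graph_Theory.Pair_Digraph"
    "Jordan_Normal_Form.Char_Poly"
begin

text \<open>
  A finite simple graph is a \<^locale>\<open>pair_graph\<close>: each edge is represented by both of its
  orientations, so that the degree of a vertex is its out-degree.
\<close>

definition johnson_vertices :: "nat \<Rightarrow> nat \<Rightarrow> real vec set" where
  "johnson_vertices n r =
     {v \<in> carrier_vec n. (\<forall>i<n. v $ i \<in> {0, 1}) \<and> v \<bullet> v = real r}"

text \<open>The requirement \<open>v \<noteq> w\<close> is only relevant for \<open>s = r\<close>, where it excludes loops.\<close>

definition johnson_graph :: "nat \<Rightarrow> nat \<Rightarrow> nat \<Rightarrow> real vec pair_pre_digraph" where
  "johnson_graph n r s =
     \<lparr> pverts = johnson_vertices n r,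
       parcs = {(v, w). v \<in> johnson_vertices n r \<and> w \<in> johnson_vertices n r \<and>
                        v \<noteq> w \<and> v \<bullet> w = real s} \<rparr>"

text \<open>Unspecified unless the graph is regular and has a vertex.\<close>

definition common_degree :: "'a pair_pre_digraph \<Rightarrow> nat" where
  "common_degree G = (THE d. \<forall>v \<in> pverts G. out_degree (with_proj G) v = d)"

definition vertex_list :: "'a pair_pre_digraph \<Rightarrow> 'a list" where
  "vertex_list G = (SOME vs. distinct vs \<and> set vs = pverts G)"

definition adjacency_matrix :: "'a pair_pre_digraph \<Rightarrow> real mat" where
  "adjacency_matrix G =
     (let vs = vertex_list G; N = length vs
      in mat N N (\<lambda>(i, j). if (vs ! i, vs ! j) \<in> parcs G then 1 else 0))"

text \<open>
  The eigenvalues with algebraic multiplicity, in non-increasing order.  A different vertex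
  enumeration conjugates the adjacency matrix by a permutation matrix, so the list does not
  depend on the choice made in \<^const>\<open>vertex_list\<close>.  The matrix is symmetric, so all
  roots of its characteristic polynomial are real and the list has one entry for each vertex.
\<close>

definition graph_eigenvalues :: "'a pair_pre_digraph \<Rightarrow> real list" where
  "graph_eigenvalues G =
     rev (sorted_list_of_multiset (proots (char_poly (adjacency_matrix G))))"

text \<open>
  List indices start at 0, so \<open>\<lambda>\<^sub>2\<close> is entry 1.  Unspecified for graphs with fewer than
  two vertices.
\<close>

definition graph_lambda :: "'a pair_pre_digraph \<Rightarrow> real" where
  "graph_lambda G = max (graph_eigenvalues G ! 1) (- last (graph_eigenvalues G))"

lemma finite_johnson_vertices: "finite (johnson_vertices n r)"
proof (rule finite_subset)
  show "johnson_vertices n r \<subseteq> vec_of_list ` {xs. set xs \<subseteq> {0, 1} \<and> length xs = n}"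
  proof
    fix v assume v: "v \<in> johnson_vertices n r"
    then have "set (list_of_vec v) \<subseteq> {0, 1}" "length (list_of_vec v) = n"
      by (auto simp: johnson_vertices_def in_set_conv_nth list_of_vec_index)
    moreover have "v = vec_of_list (list_of_vec v)"
      by (simp add: vec_list)
    ultimately show "v \<in> vec_of_list ` {xs. set xs \<subseteq> {0, 1} \<and> length xs = n}"
      by blast
  qed
qed (simp add: finite_lists_length_eq)

lemma pair_graph_johnson_graph: "pair_graph (johnson_graph n r s)"
proof
  have "parcs (johnson_graph n r s) \<subseteq> johnson_vertices n r \<times> johnson_vertices n r"
    by (auto simp: johnson_graph_def)
  then show "finite (parcs (johnson_graph n r s))"
    by (rule finite_subset) (simp add: finite_johnson_vertices)
  show "symmetric (with_proj (johnson_graph n r s))"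
    by (auto simp: symmetric_def johnson_graph_def johnson_vertices_def sym_def
        intro: comm_scalar_prod[THEN trans])
qed (auto simp: johnson_graph_def finite_johnson_vertices)

end

theory Submission
  imports Defs "HOL-Combinatorics.Transposition"
begin

text \<open>
  Let \<open>g \<noteq> 0\<close> be an eigenfunction on the \<open>r\<close>-subsets that is orthogonal to the constants.
  Antisymmetrizing it under as many disjoint transpositions \<open>(a\<^sub>i b\<^sub>i)\<close> as possible without
  killing it yields an eigenfunction for the same eigenvalue that is a multiple of
  \<open>\<Prod>i. ([a\<^sub>i \<in> W] - [b\<^sub>i \<in> W])\<close> with \<open>k \<ge> 1\<close> factors.  Evaluating at a set \<open>S\<close> with
  \<open>a\<^sub>i \<in> S\<close>, \<open>b\<^sub>i \<notin> S\<close> shows that the eigenvalue divided by the degree is the expectation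
  of this product over a random neighbour \<open>W\<close> of \<open>S\<close>.

  Reveal the pairs one at a time.  Each factor has absolute value at most 1, and it vanishes with
  probability bounded away from 0; the conditional expectation of the last factor is the
  difference of the densities of \<open>W\<close> inside and outside \<open>S\<close>, which has moved by \<open>O(k/n)\<close>
  from its initial value \<open>\<delta> = s/r - (r-s)/(n-r)\<close>.  So the expectation is at most
  \<open>(1-\<epsilon>)\<^sup>k\<^sup>-\<^sup>1 (\<bar>\<delta>\<bar> + O(k/n)) \<le> \<bar>\<delta>\<bar> + O(1/n)\<close> uniformly in \<open>k\<close>, and \<open>\<delta>\<close> has numerator
  \<open>s n - r\<^sup>2 = n (f\<^sub>s - 2 \<alpha> f\<^sub>r) - f\<^sub>r\<^sup>2\<close>.
\<close>

subsection \<open>The signed neighbour counts\<close>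

text \<open>
  The coefficient of \<open>x\<^sup>s y\<^sup>t\<close> in \<open>(x - y)\<^sup>k (1 + x)\<^sup>a\<^sup>-\<^sup>k (1 + y)\<^sup>b\<^sup>-\<^sup>k\<close>.
\<close>

fun signed_count :: "nat \<Rightarrow> nat \<Rightarrow> nat \<Rightarrow> nat \<Rightarrow> nat \<Rightarrow> real" where
  "signed_count 0 a b s t = real (a choose s) * real (b choose t)"
| "signed_count (Suc k) a b s t =
     (if s = 0 then 0 else signed_count k (a - 1) (b - 1) (s - 1) t)
     - (if t = 0 then 0 else signed_count k (a - 1) (b - 1) s (t - 1))"

section \<open>Contraction when one pair is revealed\<close>

declare signed_count.simps(2) [simp del]

text \<open>For \<open>s \<le> a\<close>, the factor \<open>1 - s / a\<close> is the probability
  that a uniform \<open>s\<close>-subset of an \<open>a\<close>-set avoids a given point. With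
  \<open>choose_pred_take\<close>, the counterpart for containing it, the recursion becomes weights
  times full counts.\<close>

lemma choose_pred_keep:
  assumes "0 < a"
  shows "real ((a - 1) choose s) = (1 - real s / real a) * real (a choose s)"
proof (cases "s \<le> a")
  case True
  have "(a - s) * (a choose s) = a * ((a - 1) choose s)"
    using binomial_absorb_comp by blast
  then have "real (a - s) * real (a choose s) = real a * real ((a - 1) choose s)"
    by (metis of_nat_mult)
  then show ?thesis using assms True by (simp add: field_simps of_nat_diff)
qed (use assms in \<open>simp add: binomial_eq_0\<close>)

lemma choose_pred_take:
  assumes "0 < a"
  shows "(if s = 0 then 0 else real ((a - 1) choose (s - 1))) = real s / real a * real (a choose s)"
proof (cases s)
  case (Suc s')
  have "Suc s' * (a choose Suc s') = a * ((a - 1) choose s')"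
    by (rule binomial_absorption)
  then have "real (Suc s') * real (a choose Suc s') = real a * real ((a - 1) choose s')"
    by (metis of_nat_mult)
  then show ?thesis using assms Suc by (simp add: field_simps)
qed simp

text \<open>A factor is nonzero only if exactly one point of the pair is chosen; with densities
  \<open>p = s / a\<close> and \<open>q = t / b\<close> this has weight
  \<open>p * (1 - q) + (1 - p) * q\<close>. The triangle inequality gives up cancellation between
  the two cases.\<close>

lemma signed_count_Suc_le:
  fixes u v :: real
  assumes a: "0 < a" and b: "0 < b"
    and take: "s \<noteq> 0 \<Longrightarrow> \<bar>signed_count k (a - 1) (b - 1) (s - 1) t\<bar>
                 \<le> u * (real ((a - 1) choose (s - 1)) * real ((b - 1) choose t))"
    and keep: "t \<noteq> 0 \<Longrightarrow> \<bar>signed_count k (a - 1) (b - 1) s (t - 1)\<bar>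
                 \<le> u * (real ((a - 1) choose s) * real ((b - 1) choose (t - 1)))"
  shows "\<bar>signed_count (Suc k) a b s t\<bar>
    \<le> u * ((real s / a * (1 - real t / b) + (1 - real s / a) * (real t / b))
             * (real (a choose s) * real (b choose t)))"
proof -
  have 1: "\<bar>if s = 0 then 0 else signed_count k (a - 1) (b - 1) (s - 1) t\<bar>
      \<le> u * ((if s = 0 then 0 else real ((a - 1) choose (s - 1))) * real ((b - 1) choose t))"
    using take by simp
  have 2: "\<bar>if t = 0 then 0 else signed_count k (a - 1) (b - 1) s (t - 1)\<bar>
      \<le> u * (real ((a - 1) choose s) * (if t = 0 then 0 else real ((b - 1) choose (t - 1))))"
    using keep by simp
  have "\<bar>signed_count (Suc k) a b s t\<bar>
      \<le> \<bar>if s = 0 then 0 else signed_count k (a - 1) (b - 1) (s - 1) t\<bar>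
        + \<bar>if t = 0 then 0 else signed_count k (a - 1) (b - 1) s (t - 1)\<bar>"
    unfolding signed_count.simps(2) by (rule abs_triangle_ineq4)
  also note add_mono[OF 1 2]
  finally show ?thesis
    unfolding choose_pred_take[OF a] choose_pred_take[OF b]
    unfolding choose_pred_keep[OF a] choose_pred_keep[OF b]
    by (simp add: algebra_simps)
qed

text \<open>The left-hand side is an average of \<open>p\<close> and \<open>1 - p\<close> with
  weights \<open>1 - q\<close> and \<open>q\<close>, and both are at most
  \<open>1 - e\<close>.\<close>

lemma bilinear_mix_le:
  fixes p q e :: real
  assumes "e \<le> p" "p \<le> 1 - e" "0 \<le> q" "q \<le> 1"
  shows "p * (1 - q) + (1 - p) * q \<le> 1 - e"
proof -
  have "p * (1 - q) \<le> (1 - e) * (1 - q)" "(1 - p) * q \<le> (1 - e) * q"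
    using assms by (intro mult_right_mono; simp)+
  then show ?thesis by (simp add: algebra_simps)
qed

text \<open>A density \<open>s / a\<close> between \<open>e\<close> and \<open>1 - e\<close> makes
  one reveal contract the relative size by \<open>1 - e\<close>, whatever the density
  \<open>t / b\<close> is. For \<open>t > b\<close> the factor \<open>b choose t\<close>
  vanishes.\<close>

lemma signed_count_contract:
  assumes "0 < a" "0 < b" "0 \<le> u" "e * real a \<le> real s" "real s \<le> (1 - e) * real a"
    and "s \<noteq> 0 \<Longrightarrow> \<bar>signed_count k (a - 1) (b - 1) (s - 1) t\<bar>
                 \<le> u * (real ((a - 1) choose (s - 1)) * real ((b - 1) choose t))"
    and "t \<noteq> 0 \<Longrightarrow> \<bar>signed_count k (a - 1) (b - 1) s (t - 1)\<bar>
                 \<le> u * (real ((a - 1) choose s) * real ((b - 1) choose (t - 1)))"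
  shows "\<bar>signed_count (Suc k) a b s t\<bar> \<le> (1 - e) * u * (real (a choose s) * real (b choose t))"
proof -
  let ?X = "real s / a * (1 - real t / b) + (1 - real s / a) * (real t / b)"
  have "?X * (real (a choose s) * real (b choose t)) \<le> (1 - e) * (real (a choose s) * real (b choose t))"
  proof (cases "t \<le> b")
    case True
    with assms(1,2,4,5) show ?thesis
      by (intro mult_right_mono bilinear_mix_le) (simp_all add: field_simps)
  qed (simp add: binomial_eq_0)
  then have "u * (?X * (real (a choose s) * real (b choose t)))
      \<le> u * ((1 - e) * (real (a choose s) * real (b choose t)))"
    using assms(3) by (rule mult_left_mono)
  moreover note signed_count_Suc_le[OF assms(1,2,6,7)]
  ultimately show ?thesis by (simp add: mult_ac)
qed

text \<open>The case \<open>e = 0\<close> of the contraction: no factor exceeds 1 in absolute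
  value.\<close>

lemma signed_count_le:
  assumes "k \<le> a" "k \<le> b"
  shows "\<bar>signed_count k a b s t\<bar> \<le> real (a choose s) * real (b choose t)"
  using assms
proof (induction k arbitrary: a b s t)
  case (Suc k)
  show ?case
  proof (cases "s \<le> a")
    case True
    have "\<bar>signed_count (Suc k) a b s t\<bar> \<le> (1 - 0) * 1 * (real (a choose s) * real (b choose t))"
      using Suc.prems True Suc.IH[of "a - 1" "b - 1"]
      by (intro signed_count_contract) simp_all
    then show ?thesis by simp
  next
    case False
    \<comment> \<open>For \<open>s > a\<close> the weight may exceed 1, but it multiplies
      \<open>a choose s\<close>, which is zero.\<close>
    have "\<bar>signed_count (Suc k) a b s t\<bar> \<le> 1 *
     ((real s / a * (1 - real t / b) + (1 - real s / a) * (real t / b))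
             * (real (a choose s) * real (b choose t)))"
      using Suc.prems Suc.IH[of "a - 1" "b - 1"]
      by (intro signed_count_Suc_le) simp_all
    with False show ?thesis by (simp add: binomial_eq_0)
  qed
qed simp

text \<open>Only the first \<open>j\<close> factors are used; the others are bounded by 1. After a
  reveal the two conditions on \<open>s\<close> hold with \<open>j - 1\<close> in place of
  \<open>j\<close>, whether or not the revealed point was chosen.\<close>

lemma signed_count_le_power:
  fixes e :: real
  assumes "j \<le> k" "k \<le> a" "k \<le> b" "0 \<le> e" "e \<le> 1"
    and "e * real a + real j \<le> real s" "real s \<le> (1 - e) * (real a - real j)"
  shows "\<bar>signed_count k a b s t\<bar> \<le> (1 - e) ^ j * (real (a choose s) * real (b choose t))"
  using assms
proof (induction j arbitrary: k a b s t)
  case 0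
  then show ?case using signed_count_le by simp
next
  case (Suc j)
  then obtain k' where k: "k = Suc k'" by (cases k) auto
  have a: "0 < a" and b: "0 < b" using Suc.prems k by auto
  have r: "real (a - 1) = real a - 1" using a by simp
  have "e * real j \<ge> 0" using \<open>0 \<le> e\<close> by simp
  have "\<bar>signed_count (Suc k') a b s t\<bar> \<le> (1 - e) * (1 - e) ^ j * (real (a choose s) * real (b choose t))"
  proof (rule signed_count_contract[OF a b])
    have "(1 - e) * (real a - real (Suc j)) \<le> (1 - e) * real a"
      using Suc.prems by (intro mult_left_mono) auto
    then show "real s \<le> (1 - e) * real a" "e * real a \<le> real s" "(1 - e) ^ j \<ge> 0"
      using Suc.prems by auto
    show "\<bar>signed_count k' (a - 1) (b - 1) (s - 1) t\<bar>
        \<le> (1 - e) ^ j * (real (a - 1 choose (s - 1)) * real (b - 1 choose t))" if "s \<noteq> 0"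
      using that Suc.prems k \<open>e * real j \<ge> 0\<close>
      by (intro Suc.IH) (auto simp: r algebra_simps)
    show "\<bar>signed_count k' (a - 1) (b - 1) s (t - 1)\<bar>
        \<le> (1 - e) ^ j * (real (a - 1 choose s) * real (b - 1 choose (t - 1)))"
      using Suc.prems k \<open>e * real j \<ge> 0\<close>
      by (intro Suc.IH) (auto simp: r algebra_simps)
  qed
  then show ?case by (simp add: k)
qed

section \<open>Drift of the densities and a bound uniform in the number of pairs\<close>

lemma density_change:
  assumes "0 < m" "real m + 1 \<le> real a" "s \<le> a"
  shows "s \<noteq> 0 \<Longrightarrow> \<bar>real (s - 1) / real (a - 1) - real s / real a\<bar> \<le> 1 / real m"
    and "s < a \<Longrightarrow> \<bar>real s / real (a - 1) - real s / real a\<bar> \<le> 1 / real m"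
proof -
  have a: "real (a - 1) = real a - 1" "0 < real a - 1" "real m \<le> real a - 1" using assms by auto
  { assume "s \<noteq> 0"
    have "real (s - 1) / real (a - 1) - real s / real a = - ((real a - real s) / real a / (real a - 1))"
      using a \<open>s \<noteq> 0\<close> by (simp add: field_simps)
    moreover have "(real a - real s) / real a / (real a - 1) \<le> 1 / real m"
      using a assms by (intro frac_le) auto
    moreover have "(real a - real s) / real a / (real a - 1) \<ge> 0" using a assms by simp
    ultimately show "\<bar>real (s - 1) / real (a - 1) - real s / real a\<bar> \<le> 1 / real m"
      by (metis abs_minus_cancel abs_of_nonneg) }
  { assume "s < a"
    have "real s / real (a - 1) - real s / real a = real s / real a / (real a - 1)"
      using a by (simp add: field_simps)
    moreover have "real s / real a / (real a - 1) \<le> 1 / real m"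
      using a assms by (intro frac_le) auto
    moreover have "real s / real a / (real a - 1) \<ge> 0" using a assms by simp
    ultimately show "\<bar>real s / real (a - 1) - real s / real a\<bar> \<le> 1 / real m"
      by (metis abs_of_nonneg) }
qed

text \<open>Here the sign is kept: \<open>p * (1 - q) - (1 - p) * q = p - q\<close> for the
  densities \<open>p\<close> and \<open>q\<close>.\<close>

lemma signed_count_1:
  assumes "0 < a" "0 < b"
  shows "signed_count (Suc 0) a b s t
    = (real s / a - real t / b) * (real (a choose s) * real (b choose t))"
proof -
  have "signed_count (Suc 0) a b s t
     = (if s = 0 then 0 else real ((a - 1) choose (s - 1))) * real ((b - 1) choose t)
      - real ((a - 1) choose s) * (if t = 0 then 0 else real ((b - 1) choose (t - 1)))"
    by (simp add: signed_count.simps(2))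
  also have "\<dots> = (real s / a - real t / b) * (real (a choose s) * real (b choose t))"
    unfolding choose_pred_take[OF assms(1)] choose_pred_take[OF assms(2)]
    unfolding choose_pred_keep[OF assms(1)] choose_pred_keep[OF assms(2)]
    by (simp add: algebra_simps)
  finally show ?thesis .
qed

text \<open>Potential for the induction: the density difference plus \<open>2 / m\<close> per
  remaining reveal does not increase when a reveal is made.\<close>

lemma abs_diff_drift:
  fixes x x' y y' :: real and m :: nat
  assumes "\<bar>x' - x\<bar> \<le> 1 / real m" "\<bar>y' - y\<bar> \<le> 1 / real m"
  shows "\<bar>x' - y'\<bar> + real k * (2 / real m) \<le> \<bar>x - y\<bar> + real (Suc k) * (2 / real m)"
proof -
  define h where "h = 1 / real m"
  have m: "2 / real m = h + h" by (simp add: h_def)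
  have "\<bar>x' - y'\<bar> \<le> \<bar>x - y\<bar> + (h + h)" using assms unfolding h_def[symmetric] by linarith
  then show ?thesis unfolding m of_nat_Suc distrib_right by simp
qed

text \<open>The first \<open>k\<close> factors contract by \<open>1 - e\<close> each, and the last
  contributes the density difference at that moment. \<open>k + m < a\<close> and
  \<open>k + m < b\<close> keep the denominators large enough for a drift of at most
  \<open>1 / m\<close> per reveal on each side.\<close>

lemma signed_count_le_density:
  fixes e :: real and m :: nat
  assumes "0 < m" "k + m < a" "k + m < b" "0 \<le> e" "e \<le> 1"
    and "e * real a + real k \<le> real s" "real s \<le> (1 - e) * (real a - real k)"
  shows "\<bar>signed_count (Suc k) a b s t\<bar>
    \<le> (1 - e) ^ k * (\<bar>real s / a - real t / b\<bar> + real k * (2 / m)) * (real (a choose s) * real (b choose t))"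
  using assms
proof (induction k arbitrary: a b s t)
  case 0
  then show ?case by (subst signed_count_1) (simp_all add: abs_mult)
next
  case (Suc k)
  show ?case
  proof (cases "t \<le> b")
    case False
    then show ?thesis using signed_count_le[of "Suc (Suc k)" a b s t] Suc.prems by (simp add: binomial_eq_0)
  next
    case True
    have a: "0 < a" and b: "0 < b" using Suc.prems by auto
    have r: "real (a - 1) = real a - 1" using a by simp
    have ek: "e * real k \<ge> 0" using \<open>0 \<le> e\<close> by simp
    have e1: "0 \<le> e" "e \<le> 1" using Suc.prems by auto
    let ?D = "\<bar>real s / a - real t / b\<bar>"
    let ?u = "(1 - e) ^ k * (?D + real (Suc k) * (2 / m))"
    have sa: "real s \<le> (1 - e) * real a" "s < a"
    proof -
      have "(1 - e) * (real a - real (Suc k)) \<le> 1 * (real a - real (Suc k))"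
        using Suc.prems by (intro mult_right_mono) auto
      then have "real s \<le> real a - real (Suc k)" using order_trans[OF Suc.prems(7)] by auto
      then show "s < a" by linarith
      have "(1 - e) * (real a - real (Suc k)) \<le> (1 - e) * real a"
        using Suc.prems by (intro mult_left_mono) auto
      then show "real s \<le> (1 - e) * real a" using Suc.prems(7) by (rule order_trans[rotated])
    qed
    have "\<bar>signed_count (Suc (Suc k)) a b s t\<bar> \<le> (1 - e) * ?u * (real (a choose s) * real (b choose t))"
    proof (rule signed_count_contract[OF a b])
      show "real s \<le> (1 - e) * real a" "e * real a \<le> real s" "0 \<le> ?u"
        using Suc.prems sa by auto
      show "\<bar>signed_count (Suc k) (a - 1) (b - 1) (s - 1) t\<bar>
        \<le> ?u * (real (a - 1 choose (s - 1)) * real (b - 1 choose t))" if "s \<noteq> 0"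
      proof (cases "t < b")
        case True
        have "\<bar>signed_count (Suc k) (a - 1) (b - 1) (s - 1) t\<bar>
          \<le> (1 - e) ^ k * (\<bar>real (s - 1) / real (a - 1) - real t / real (b - 1)\<bar> + real k * (2 / m))
            * (real (a - 1 choose (s - 1)) * real (b - 1 choose t))"
          using that Suc.prems ek
          by (intro Suc.IH) (auto simp: r algebra_simps)
        also have "\<dots> \<le> ?u * (real (a - 1 choose (s - 1)) * real (b - 1 choose t))"
        proof (intro mult_right_mono mult_left_mono)
          have "\<bar>real (s - 1) / real (a - 1) - real s / real a\<bar> \<le> 1 / real m"
            using Suc.prems sa that by (intro density_change) auto
          moreover have "\<bar>real t / real (b - 1) - real t / real b\<bar> \<le> 1 / real m"
            using Suc.prems True by (intro density_change) auto
          ultimately show "\<bar>real (s - 1) / real (a - 1) - real t / real (b - 1)\<bar> + real k * (2 / m)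
              \<le> ?D + real (Suc k) * (2 / m)"
            by (rule abs_diff_drift)
        qed (use e1 in auto)
        finally show ?thesis .
      next
        case False
        \<comment> \<open>For \<open>t = b\<close> the removed point cannot be unchosen, and
          \<open>b - 1 choose t\<close> is zero.\<close>
        then show ?thesis using signed_count_le[of "Suc k" "a - 1" "b - 1" "s - 1" t] Suc.prems b
          by (simp add: binomial_eq_0)
      qed
      show "\<bar>signed_count (Suc k) (a - 1) (b - 1) s (t - 1)\<bar>
        \<le> ?u * (real (a - 1 choose s) * real (b - 1 choose (t - 1)))" if "t \<noteq> 0"
      proof -
        have "\<bar>signed_count (Suc k) (a - 1) (b - 1) s (t - 1)\<bar>
          \<le> (1 - e) ^ k * (\<bar>real s / real (a - 1) - real (t - 1) / real (b - 1)\<bar> + real k * (2 / m))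
            * (real (a - 1 choose s) * real (b - 1 choose (t - 1)))"
          using that Suc.prems ek
          by (intro Suc.IH) (auto simp: r algebra_simps)
        also have "\<dots> \<le> ?u * (real (a - 1 choose s) * real (b - 1 choose (t - 1)))"
        proof (intro mult_right_mono mult_left_mono)
          have "\<bar>real s / real (a - 1) - real s / real a\<bar> \<le> 1 / real m"
            using Suc.prems sa by (intro density_change) auto
          moreover have "\<bar>real (t - 1) / real (b - 1) - real t / real b\<bar> \<le> 1 / real m"
            using Suc.prems True that by (intro density_change) auto
          ultimately show "\<bar>real s / real (a - 1) - real (t - 1) / real (b - 1)\<bar> + real k * (2 / m)
              \<le> ?D + real (Suc k) * (2 / m)"
            by (rule abs_diff_drift)
        qed (use e1 in auto)
        finally show ?thesis .
      qed
    qed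
    then show ?thesis by (simp only: power_Suc mult_ac)
  qed
qed

text \<open>\<open>x ^ k\<close> is the smallest of the first \<open>k + 1\<close> terms of the
  geometric series. With \<open>x = 1 - e\<close>, the decay absorbs a drift that is linear in the
  number of pairs.\<close>

lemma Suc_mult_power_le:
  fixes x :: real
  assumes "0 \<le> x" "x < 1"
  shows "real (Suc k) * x ^ k \<le> 1 / (1 - x)"
proof -
  have "real (Suc k) * x ^ k = (\<Sum>j<Suc k. x ^ k)" by simp
  also have "\<dots> \<le> (\<Sum>j<Suc k. x ^ j)"
    using assms by (intro sum_mono power_decreasing) auto
  also have "\<dots> = (1 - x ^ Suc k) / (1 - x)" using assms sum_gp_strict[of x "Suc k"] by simp
  also have "\<dots> \<le> 1 / (1 - x)" using assms by (intro divide_right_mono) auto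
  finally show ?thesis .
qed

text \<open>For \<open>k \<le> m\<close> the accumulated drift \<open>2 * (k - 1) / m\<close> is
  damped by \<open>(1 - e) ^ (k - 1)\<close>. The case split is at \<open>m\<close> because the
  hypotheses control the densities only through \<open>m\<close> reveals.\<close>

lemma signed_count_bound:
  fixes e :: real and m :: nat
  assumes "0 < e" "e < 1" "0 < m" "0 < k" "k \<le> a" "k \<le> b"
    and "2 * m < a" "2 * m < b"
    and "e * real a + real m \<le> real s" "real s \<le> (1 - e) * (real a - real m)"
  shows "\<bar>signed_count k a b s t\<bar>
    \<le> (\<bar>real s / a - real t / b\<bar> + 2 / (e * m)) * (real (a choose s) * real (b choose t))"
proof (cases "k \<le> m")
  case True
  obtain j where k: "k = Suc j" using \<open>0 < k\<close> by (cases k) auto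
  have *: "(1 - e) * (real a - real m) \<le> (1 - e) * (real a - real j)"
    using assms(2) True k by (intro mult_left_mono) auto
  have **: "real s \<le> (1 - e) * (real a - real j)" using * assms(10) by linarith
  have "\<bar>signed_count (Suc j) a b s t\<bar>
      \<le> (1 - e) ^ j * (\<bar>real s / a - real t / b\<bar> + real j * (2 / m)) * (real (a choose s) * real (b choose t))"
    by (rule signed_count_le_density) (use assms True k ** in auto)
  also have "\<dots> \<le> (\<bar>real s / a - real t / b\<bar> + 2 / (e * m)) * (real (a choose s) * real (b choose t))"
  proof (rule mult_right_mono)
    have "(1 - e) ^ j * \<bar>real s / a - real t / b\<bar> \<le> \<bar>real s / a - real t / b\<bar>"
      using assms by (intro mult_left_le_one_le power_le_one) auto
    moreover have "(1 - e) ^ j * (real j * (2 / m)) \<le> 2 / (e * m)"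
    proof -
      have "real j * (1 - e) ^ j \<le> real (Suc j) * (1 - e) ^ j"
        using assms by (intro mult_right_mono) auto
      also have "\<dots> \<le> 1 / e" using Suc_mult_power_le[of "1 - e" j] assms by simp
      finally have "real j * (1 - e) ^ j * (2 / m) \<le> 1 / e * (2 / m)"
        by (intro mult_right_mono) auto
      then show ?thesis by (simp add: mult_ac)
    qed
    ultimately show "(1 - e) ^ j * (\<bar>real s / a - real t / b\<bar> + real j * (2 / m))
        \<le> \<bar>real s / a - real t / b\<bar> + 2 / (e * m)" by (simp add: distrib_left)
  qed simp
  finally show ?thesis by (simp add: k)
next
  case False
  (* The first m factors alone already give a bound of order 1/m. *)
  have "\<bar>signed_count k a b s t\<bar> \<le> (1 - e) ^ m * (real (a choose s) * real (b choose t))"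
    by (rule signed_count_le_power) (use assms False in auto)
  also have "\<dots> \<le> (\<bar>real s / a - real t / b\<bar> + 2 / (e * m)) * (real (a choose s) * real (b choose t))"
  proof (rule mult_right_mono)
    have "real m * (1 - e) ^ m \<le> real (Suc m) * (1 - e) ^ m"
      using assms by (intro mult_right_mono) auto
    also have "\<dots> \<le> 1 / e" using Suc_mult_power_le[of "1 - e" m] assms by simp
    finally have "(1 - e) ^ m \<le> 1 / (e * m)" using assms by (simp add: field_simps)
    also have "\<dots> \<le> 2 / (e * m)" using assms by (intro divide_right_mono) auto
    finally show "(1 - e) ^ m \<le> \<bar>real s / a - real t / b\<bar> + 2 / (e * m)" by simp
  qed simp
  finally show ?thesis .
qed

subsection \<open>Eigenfunctions on subsets of fixed size\<close>

definition subsets_of_card :: "'a set \<Rightarrow> nat \<Rightarrow> 'a set set" where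
  "subsets_of_card X s = {W. W \<subseteq> X \<and> card W = s}"

lemma finite_subsets_of_card [simp]: "finite X \<Longrightarrow> finite (subsets_of_card X s)"
  by (simp add: subsets_of_card_def)

lemma card_subsets_of_card: "finite X \<Longrightarrow> card (subsets_of_card X s) = card X choose s"
  unfolding subsets_of_card_def by (rule n_subsets)

lemma sum_subsets_of_card_insert:
  fixes h :: "'a set \<Rightarrow> real"
  assumes "finite X" "a \<notin> X"
  shows "(\<Sum>W\<in>subsets_of_card (insert a X) s. h W)
    = (if s = 0 then 0 else \<Sum>W\<in>subsets_of_card X (s - 1). h (insert a W))
      + (\<Sum>W\<in>subsets_of_card X s. h W)"
proof (cases s)
  case 0
  have "subsets_of_card Y 0 = {{}}" if "finite Y" for Y :: "'a set"
    using that by (auto simp: subsets_of_card_def dest: finite_subset)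
  with 0 show ?thesis using assms by simp
next
  case (Suc s')
  have fin: "finite W" if "W \<subseteq> X" for W using that assms finite_subset by blast
  have "subsets_of_card (insert a X) s
      = insert a ` subsets_of_card X s' \<union> subsets_of_card X s" (is "?L = ?R")
  proof
    show "?L \<subseteq> ?R"
    proof
      fix W assume W: "W \<in> ?L"
      show "W \<in> ?R"
      proof (cases "a \<in> W")
        case True
        then have "card (W - {a}) = s'" using W Suc by (simp add: subsets_of_card_def)
        then have "W - {a} \<in> subsets_of_card X s'" using W by (auto simp: subsets_of_card_def)
        then show ?thesis using True by (metis UnI1 image_eqI insert_Diff)
      qed (use W in \<open>auto simp: subsets_of_card_def\<close>)
    qed
    show "?R \<subseteq> ?L" using assms(2) fin Suc
      by (auto simp: subsets_of_card_def card_insert_if)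
  qed
  moreover have "insert a ` subsets_of_card X s' \<inter> subsets_of_card X s = {}"
    using assms(2) by (auto simp: subsets_of_card_def)
  moreover have "inj_on (insert a) (subsets_of_card X s')"
    using assms(2) by (auto simp: inj_on_def subsets_of_card_def)
  ultimately show ?thesis using assms(1) Suc
    by (simp add: sum.union_disjoint sum.reindex)
qed

text \<open>\<open>A\<close> holds one point of each pair and \<open>m\<close> sends it to its
  partner. The value is nonzero only on sets that split every pair, and there it is 1 or -1 by the
  parity of the number of partners contained in \<open>W\<close>.\<close>

definition pairing_weight :: "('a \<Rightarrow> 'a) \<Rightarrow> 'a set \<Rightarrow> 'a set \<Rightarrow> real" where
  "pairing_weight m A W = (\<Prod>x\<in>A. of_bool (x \<in> W) - of_bool (m x \<in> W))"

text \<open>Induction on \<open>A\<close>, removing \<open>a\<close> from \<open>X\<close> and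
  \<open>m a\<close> from \<open>Y\<close>: only the sets with exactly one of these points survive,
  with sign 1 for \<open>a\<close> and -1 for \<open>m a\<close>. This is the recursion of
  \<open>signed_count\<close>.\<close>

lemma sum_pairing_weight:
  assumes "finite A" "finite X" "finite Y" "A \<subseteq> X" "m ` A \<subseteq> Y" "inj_on m A" "X \<inter> Y = {}"
  shows "(\<Sum>U\<in>subsets_of_card X s. \<Sum>V\<in>subsets_of_card Y t. pairing_weight m A (U \<union> V))
    = signed_count (card A) (card X) (card Y) s t"
  using assms
proof (induction A arbitrary: X Y s t)
  case empty
  then show ?case by (simp add: pairing_weight_def card_subsets_of_card)
next
  case (insert a A)
  define X' Y' where "X' = X - {a}" and "Y' = Y - {m a}"
  have X: "X = insert a X'" "a \<notin> X'" "finite X'" and Y: "Y = insert (m a) Y'" "m a \<notin> Y'" "finite Y'"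
    using insert.prems by (auto simp: X'_def Y'_def)
  have sub: "A \<subseteq> X'" "m ` A \<subseteq> Y'" "inj_on m A" "X' \<inter> Y' = {}"
    using insert.prems insert.hyps inj_onD[OF insert.prems(5), of _ a] by (auto simp: X'_def Y'_def)
  have ne: "m a \<noteq> a" "a \<notin> Y'" "m a \<notin> X'" using insert.prems X Y by auto
  have nin: "a \<notin> U" "m a \<notin> U" "a \<notin> V" "m a \<notin> V"
    if "U \<in> subsets_of_card X' i" "V \<in> subsets_of_card Y' j" for U V i j
    using that X Y ne by (auto simp: subsets_of_card_def)
  have mx: "x \<noteq> a" "m x \<noteq> a" "x \<noteq> m a" "m x \<noteq> m a" if "x \<in> A" for x
  proof -
    show "x \<noteq> a" "m x \<noteq> a" "x \<noteq> m a" using that sub insert.hyps X Y ne by auto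
    show "m x \<noteq> m a" using inj_onD[OF insert.prems(5), of x a] that insert.hyps by auto
  qed
  have pw: "pairing_weight m A (insert a W) = pairing_weight m A W"
    "pairing_weight m A (insert (m a) W) = pairing_weight m A W" for W
    unfolding pairing_weight_def by (intro prod.cong refl; use mx in auto)+
  have w: "pairing_weight m (insert a A) (U \<union> V) = 0"
    "pairing_weight m (insert a A) (insert a U \<union> V) = pairing_weight m A (U \<union> V)"
    "pairing_weight m (insert a A) (U \<union> insert (m a) V) = - pairing_weight m A (U \<union> V)"
    "pairing_weight m (insert a A) (insert a U \<union> insert (m a) V) = 0"
    if "U \<in> subsets_of_card X' i" "V \<in> subsets_of_card Y' j" for U V i j
  proof -
    have *: "pairing_weight m (insert a A) W = (of_bool (a \<in> W) - of_bool (m a \<in> W)) * pairing_weight m A W" for W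
      using insert.hyps by (simp add: pairing_weight_def)
    show "pairing_weight m (insert a A) (U \<union> V) = 0"
    "pairing_weight m (insert a A) (insert a U \<union> V) = pairing_weight m A (U \<union> V)"
    "pairing_weight m (insert a A) (U \<union> insert (m a) V) = - pairing_weight m A (U \<union> V)"
    "pairing_weight m (insert a A) (insert a U \<union> insert (m a) V) = 0"
      unfolding * using nin[OF that] ne pw by simp_all
  qed
  have IH: "(\<Sum>U\<in>subsets_of_card X' s. \<Sum>V\<in>subsets_of_card Y' t. pairing_weight m A (U \<union> V))
    = signed_count (card A) (card X') (card Y') s t" for s t
    by (rule insert.IH[OF X(3) Y(3) sub])
  have inner: "(\<Sum>V\<in>subsets_of_card Y t. pairing_weight m (insert a A) (U \<union> V))
      = - (if t = 0 then 0 else \<Sum>V\<in>subsets_of_card Y' (t - 1). pairing_weight m A (U \<union> V))"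
    "(\<Sum>V\<in>subsets_of_card Y t. pairing_weight m (insert a A) (insert a U \<union> V))
      = (\<Sum>V\<in>subsets_of_card Y' t. pairing_weight m A (U \<union> V))"
    if U: "U \<in> subsets_of_card X' i" for U i
    unfolding Y(1) sum_subsets_of_card_insert[OF Y(3,2)]
    by (simp_all only: w[OF U] sum.neutral_const sum_negf cong: sum.cong) simp_all
  have cards: "card X = Suc (card X')" "card Y = Suc (card Y')" using X Y by simp_all
  have "(\<Sum>U\<in>subsets_of_card X s. \<Sum>V\<in>subsets_of_card Y t. pairing_weight m (insert a A) (U \<union> V))
      = (if s = 0 then 0 else \<Sum>U\<in>subsets_of_card X' (s - 1).
            \<Sum>V\<in>subsets_of_card Y' t. pairing_weight m A (U \<union> V))
        + (\<Sum>U\<in>subsets_of_card X' s. - (if t = 0 then 0 else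
            \<Sum>V\<in>subsets_of_card Y' (t - 1). pairing_weight m A (U \<union> V)))"
    unfolding X(1) sum_subsets_of_card_insert[OF X(3,2)]
    using inner by (simp cong: sum.cong)
  also have "\<dots> = signed_count (card (insert a A)) (card X) (card Y) s t"
    using insert.hyps by (simp add: IH sum_negf cards signed_count.simps(2))
  finally show ?case .
qed

lemma sum_neighbours_eq:
  fixes h :: "'a set \<Rightarrow> real"
  assumes "finite X" "S \<in> subsets_of_card X r" "s \<le> r"
  shows "(\<Sum>W | W \<in> subsets_of_card X r \<and> card (S \<inter> W) = s. h W)
    = (\<Sum>U\<in>subsets_of_card S s. \<Sum>V\<in>subsets_of_card (X - S) (r - s). h (U \<union> V))"
proof -
  have S: "S \<subseteq> X" "card S = r" using assms by (auto simp: subsets_of_card_def)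
  have fin: "finite W" if "W \<subseteq> X" for W using that assms finite_subset by blast
  have "(\<Sum>U\<in>subsets_of_card S s. \<Sum>V\<in>subsets_of_card (X - S) (r - s). h (U \<union> V))
    = (\<Sum>(U, V)\<in>subsets_of_card S s \<times> subsets_of_card (X - S) (r - s). h (U \<union> V))"
    by (rule sum.cartesian_product)
  also have "\<dots> = (\<Sum>W | W \<in> subsets_of_card X r \<and> card (S \<inter> W) = s. h W)"
  proof (rule sum.reindex_bij_witness[of _ "\<lambda>W. (S \<inter> W, W - S)" "\<lambda>(U, V). U \<union> V"])
    fix p assume "p \<in> subsets_of_card S s \<times> subsets_of_card (X - S) (r - s)"
    then obtain U V where p: "p = (U, V)" "U \<subseteq> S" "card U = s" "V \<subseteq> X - S" "card V = r - s"
      by (auto simp: subsets_of_card_def)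
    have "card (U \<union> V) = r"
      using p assms(3) S fin[of U] fin[of V] by (subst card_Un_disjoint) auto
    moreover have "S \<inter> (U \<union> V) = U" "U \<union> V - S = V" using p by auto
    ultimately show "(\<lambda>W. (S \<inter> W, W - S)) ((\<lambda>(U, V). U \<union> V) p) = p"
      "(\<lambda>(U, V). U \<union> V) p \<in> {W. W \<in> subsets_of_card X r \<and> card (S \<inter> W) = s}"
      "h ((\<lambda>(U, V). U \<union> V) p) = (\<lambda>(U, V). h (U \<union> V)) p"
      using p S by (auto simp: subsets_of_card_def)
  next
    fix W assume "W \<in> {W. W \<in> subsets_of_card X r \<and> card (S \<inter> W) = s}"
    then have W: "W \<subseteq> X" "card W = r" "card (S \<inter> W) = s" by (auto simp: subsets_of_card_def)
    have "card (W - S) = r - s"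
      using W fin[of W] by (metis Int_commute card_Diff_subset_Int finite_Int)
    then show "(\<lambda>(U, V). U \<union> V) ((\<lambda>W. (S \<inter> W, W - S)) W) = W"
      "(\<lambda>W. (S \<inter> W, W - S)) W \<in> subsets_of_card S s \<times> subsets_of_card (X - S) (r - s)"
      using W by (auto simp: subsets_of_card_def)
  qed
  finally show ?thesis by simp
qed

text \<open>The second conjunct is orthogonality to the constants. The zero function qualifies; a
  nonzero value is demanded separately where the eigenvalue is read off.\<close>

definition johnson_eigenfunction ::
    "'a set \<Rightarrow> nat \<Rightarrow> nat \<Rightarrow> real \<Rightarrow> ('a set \<Rightarrow> real) \<Rightarrow> bool" where
  "johnson_eigenfunction X r s \<mu> g \<longleftrightarrow>
     (\<forall>S\<in>subsets_of_card X r.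
        (\<Sum>W | W \<in> subsets_of_card X r \<and> card (S \<inter> W) = s. g W) = \<mu> * g S)
     \<and> (\<Sum>S\<in>subsets_of_card X r. g S) = 0"

section \<open>Transpositions acting on eigenfunctions\<close>

lemma transpose_image_twice [simp]: "transpose a b ` (transpose a b ` S) = S"
  by (simp add: image_comp)

lemma transpose_image_subsets_of_card:
  assumes "a \<in> X" "b \<in> X" "S \<in> subsets_of_card X r"
  shows "transpose a b ` S \<in> subsets_of_card X r"
proof -
  have "card (transpose a b ` S) = card S" by (simp add: card_image)
  moreover have "transpose a b x \<in> X" if "x \<in> X" for x using that assms by (simp add: transpose_def)
  ultimately show ?thesis using assms(3) by (auto simp: subsets_of_card_def)
qed

lemma sum_transpose_image:
  fixes h :: "'a set \<Rightarrow> real"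
  assumes "a \<in> X" "b \<in> X"
  shows "(\<Sum>W\<in>subsets_of_card X r. h (transpose a b ` W)) = (\<Sum>W\<in>subsets_of_card X r. h W)"
  by (rule sum.reindex_bij_witness[of _ "(`) (transpose a b)" "(`) (transpose a b)"])
     (use assms transpose_image_subsets_of_card in auto)

lemma sum_neighbours_transpose_image:
  fixes h :: "'a set \<Rightarrow> real"
  assumes "a \<in> X" "b \<in> X"
  shows "(\<Sum>W | W \<in> subsets_of_card X r \<and> card (S \<inter> W) = s. h (transpose a b ` W))
    = (\<Sum>W | W \<in> subsets_of_card X r \<and> card (transpose a b ` S \<inter> W) = s. h W)"
proof (rule sum.reindex_bij_witness[of _ "(`) (transpose a b)" "(`) (transpose a b)"])
  have *: "card (transpose a b ` S \<inter> transpose a b ` W) = card (S \<inter> W)" for S W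
    by (simp add: card_image flip: image_Int)
  then have **: "card (S \<inter> transpose a b ` W) = card (transpose a b ` S \<inter> W)" for W
    by (metis transpose_image_twice)
  show "transpose a b ` W \<in> {W \<in> subsets_of_card X r. card (transpose a b ` S \<inter> W) = s}"
    if "W \<in> {W \<in> subsets_of_card X r. card (S \<inter> W) = s}" for W
    using that assms * by (simp add: transpose_image_subsets_of_card)
  show "transpose a b ` W \<in> {W \<in> subsets_of_card X r. card (S \<inter> W) = s}"
    if "W \<in> {W \<in> subsets_of_card X r. card (transpose a b ` S \<inter> W) = s}" for W
    using that assms ** by (simp add: transpose_image_subsets_of_card)
qed simp_all

text \<open>Transpositions preserve intersection sizes, so they are graph automorphisms: they map
  the eigenspace to itself and leave the sum over all vertices unchanged.\<close>

lemma johnson_eigenfunction_antisymmetrize: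
  assumes "johnson_eigenfunction X r s \<mu> g" "a \<in> X" "b \<in> X"
  shows "johnson_eigenfunction X r s \<mu> (\<lambda>S. g S - g (transpose a b ` S))"
  using assms
  by (auto simp: johnson_eigenfunction_def sum_subtractf sum_transpose_image
      sum_neighbours_transpose_image transpose_image_subsets_of_card right_diff_distrib)

text \<open>
  The pairs \<open>{x, m x}\<close> with \<open>x \<in> Q\<close> are disjoint, and the function changes sign under
  each of the transpositions they define.
\<close>

definition antisymmetric_on :: "'a set \<Rightarrow> nat \<Rightarrow> 'a set \<Rightarrow> ('a \<Rightarrow> 'a) \<Rightarrow> ('a set \<Rightarrow> real) \<Rightarrow> bool" where
  "antisymmetric_on X r Q m g \<longleftrightarrow> Q \<subseteq> X
     \<and> (\<forall>x\<in>Q. m x \<in> Q \<and> m (m x) = x \<and> m x \<noteq> x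
         \<and> (\<forall>S\<in>subsets_of_card X r. g (transpose x (m x) ` S) = - g S))"

text \<open>The new transposition is disjoint from the old ones and commutes with them, so their
  sign changes persist; under the involution \<open>transpose a b\<close> itself, the two terms of
  the difference trade places.\<close>

lemma antisymmetric_on_extend:
  assumes Q: "antisymmetric_on X r Q m g" and ab: "a \<in> X - Q" "b \<in> X - Q" "a \<noteq> b"
  shows "antisymmetric_on X r (insert a (insert b Q)) (m(a := b, b := a))
           (\<lambda>S. g S - g (transpose a b ` S))"
proof -
  have "g (transpose x (m x) ` S) - g (transpose a b ` (transpose x (m x) ` S))
      = - (g S - g (transpose a b ` S))"
    if x: "x \<in> Q" and S: "S \<in> subsets_of_card X r" for x S
  proof -
    have "transpose a b \<circ> transpose x (m x) = transpose x (m x) \<circ> transpose a b"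
      using x ab Q by (intro ext) (auto simp: antisymmetric_on_def transpose_def)
    then have "transpose a b ` (transpose x (m x) ` S) = transpose x (m x) ` (transpose a b ` S)"
      by (metis image_comp)
    moreover have "transpose a b ` S \<in> subsets_of_card X r"
      using ab S by (intro transpose_image_subsets_of_card) auto
    ultimately show ?thesis using Q x S by (simp add: antisymmetric_on_def)
  qed
  then show ?thesis using Q ab
    by (auto simp: antisymmetric_on_def transpose_commute[of b a])
qed

text \<open>All values of \<open>g\<close> follow from the one at \<open>S\<close>, by induction on
  \<open>card (W - S)\<close>. If \<open>W\<close> fails to split a pair, both sides are zero; if it
  holds the wrong point of a pair, swapping the pair negates both sides; otherwise \<open>W\<close>
  agrees with \<open>S\<close> on \<open>Q\<close>, and exchanging points outside \<open>Q\<close>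
  changes neither side.\<close>

lemma eq_pairing_weight:
  assumes X: "finite X" and Q: "antisymmetric_on X r Q m g"
    and inv: "\<And>a b S. \<lbrakk>a \<in> X - Q; b \<in> X - Q; S \<in> subsets_of_card X r\<rbrakk> \<Longrightarrow> g (transpose a b ` S) = g S"
    and S: "S \<in> subsets_of_card X r" "g S \<noteq> 0"
    and W: "W \<in> subsets_of_card X r"
  shows "g W = g S * pairing_weight m (Q \<inter> S) W"
proof -
  have m: "m x \<in> Q" "m (m x) = x" "m x \<noteq> x" if "x \<in> Q" for x
    using Q that by (auto simp: antisymmetric_on_def)
  have anti: "g (transpose x (m x) ` T) = - g T" if "x \<in> Q" "T \<in> subsets_of_card X r" for x T
    using Q that by (auto simp: antisymmetric_on_def)
  have QX: "Q \<subseteq> X" using Q by (simp add: antisymmetric_on_def)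
  \<comment> \<open>Such a \<open>T\<close> is fixed by a transposition that negates
    \<open>g\<close>.\<close>
  have zero: "g T = 0" if "x \<in> Q" "T \<in> subsets_of_card X r" "x \<in> T \<longleftrightarrow> m x \<in> T" for x T
  proof -
    have "transpose x (m x) ` T = T" using that(3) by (rule transpose_image_eq)
    then show ?thesis using anti[OF that(1,2)] by simp
  qed
  \<comment> \<open>As \<open>g S\<close> is nonzero, \<open>S\<close> splits every pair, so
    \<open>Q \<inter> S\<close> contains exactly one point of each.\<close>
  have one: "x \<in> S \<longleftrightarrow> m x \<notin> S" if "x \<in> Q" for x using zero[OF that S(1)] S(2) by blast
  have fin: "finite T" if "T \<subseteq> X" for T using that X finite_subset by blast
  have finA: "finite (Q \<inter> S)" using S fin by (auto simp: subsets_of_card_def)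
  show ?thesis using W
  proof (induction "card (W - S)" arbitrary: W rule: less_induct)
    case less
    have WX: "W \<subseteq> X" "finite W" using less.prems fin by (auto simp: subsets_of_card_def)
    have swap: "transpose x y ` W = insert y (W - {x})" if "x \<in> W" "y \<notin> W" for x y
      using that by (auto simp: transpose_def image_iff)
    have smaller: "card (insert y (W - {x}) - S) < card (W - S)" if "x \<in> W" "x \<notin> S" "y \<in> S" for x y
      using that WX by (intro psubset_card_mono) auto
    consider (degenerate) x where "x \<in> Q" "x \<in> W \<longleftrightarrow> m x \<in> W"
      | (flipped) x where "x \<in> Q \<inter> S" "x \<notin> W" "m x \<in> W"
      | (aligned) "\<forall>x\<in>Q \<inter> S. x \<in> W \<and> m x \<notin> W" by blast
    then show ?case
    proof cases
      case degenerate
      have "\<exists>y\<in>Q \<inter> S. of_bool (y \<in> W) - of_bool (m y \<in> W) = (0 :: real)"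
      proof (cases "x \<in> S")
        case True then show ?thesis using degenerate by (intro bexI[of _ x]) auto
      next
        case False
        then show ?thesis using degenerate m[of x] one[of x] by (intro bexI[of _ "m x"]) auto
      qed
      then have "pairing_weight m (Q \<inter> S) W = 0"
        unfolding pairing_weight_def by (rule prod_zero[OF finA])
      then show ?thesis using zero[OF degenerate(1) less.prems degenerate(2)] by simp
    next
      case flipped
      let ?W = "transpose x (m x) ` W"
      have x: "x \<in> Q" "x \<in> S" "m x \<notin> S" using flipped one by auto
      have W': "?W = insert x (W - {m x})"
        using swap[OF flipped(3,2)] by (simp add: transpose_commute)
      have in': "?W \<in> subsets_of_card X r"
        using less.prems x m QX by (intro transpose_image_subsets_of_card) auto
      have "card (?W - S) < card (W - S)" unfolding W' using flipped x by (intro smaller) auto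
      then have "g ?W = g S * pairing_weight m (Q \<inter> S) ?W" using in' by (rule less.hyps)
      moreover have "pairing_weight m (Q \<inter> S) ?W = - pairing_weight m (Q \<inter> S) W"
      proof -
        have A: "Q \<inter> S = insert x (Q \<inter> S - {x})" "finite (Q \<inter> S - {x})" using flipped finA by auto
        have "(\<Prod>y\<in>Q \<inter> S - {x}. of_bool (y \<in> ?W) - of_bool (m y \<in> ?W) :: real)
          = (\<Prod>y\<in>Q \<inter> S - {x}. of_bool (y \<in> W) - of_bool (m y \<in> W))"
        proof (intro prod.cong refl)
          fix y assume y: "y \<in> Q \<inter> S - {x}"
          have "y \<noteq> m x" "m y \<noteq> x" "m y \<noteq> m x" using y x m by (auto, metis+)
          then show "of_bool (y \<in> ?W) - of_bool (m y \<in> ?W) = (of_bool (y \<in> W) - of_bool (m y \<in> W) :: real)"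
            using y unfolding W' by auto
        qed
        moreover have "x \<in> ?W" "m x \<notin> ?W" unfolding W' using m[OF x(1)] by auto
        ultimately show ?thesis unfolding pairing_weight_def
          using flipped by (subst (1 2) A(1), subst (1 2) prod.insert) (use A(2) in auto)
      qed
      ultimately show ?thesis using anti[OF x(1) less.prems] by simp
    next
      case aligned
      have QW: "z \<in> S" if "z \<in> Q" "z \<in> W" for z using aligned that one m by (metis IntI)
      show ?thesis
      proof (cases "W = S")
        case True
        have "pairing_weight m (Q \<inter> S) W = 1"
          unfolding pairing_weight_def by (rule prod.neutral) (use aligned in auto)
        then show ?thesis using True by simp
      next
        case False
        have cardeq: "card W = card S" and finS: "finite S"
          using less.prems S fin by (auto simp: subsets_of_card_def)
        \<comment> \<open>\<open>W\<close> and \<open>S\<close> differ but have equal size, so each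
          has a point that the other lacks; these points lie outside \<open>Q\<close>, where alone
          the two sets differ.\<close>
        obtain x where x: "x \<in> W" "x \<notin> S"
          using False cardeq finS by (metis card_subset_eq subsetI)
        obtain y where y: "y \<in> S" "y \<notin> W"
          using False cardeq WX by (metis card_subset_eq subsetI)
        have out: "x \<in> X - Q" "y \<in> X - Q"
          using x y QW aligned WX S by (auto simp: subsets_of_card_def)
        let ?W = "transpose x y ` W"
        have W': "?W = insert y (W - {x})" using swap x y by blast
        have in': "?W \<in> subsets_of_card X r"
          using less.prems out by (intro transpose_image_subsets_of_card) auto
        have "card (?W - S) < card (W - S)" unfolding W' using x y by (intro smaller) auto
        then have "g ?W = g S * pairing_weight m (Q \<inter> S) ?W" using in' by (rule less.hyps)
        moreover have "pairing_weight m (Q \<inter> S) ?W = pairing_weight m (Q \<inter> S) W"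
          unfolding pairing_weight_def
        proof (intro prod.cong refl)
          fix z assume z: "z \<in> Q \<inter> S"
          then have "z \<noteq> x" "z \<noteq> y" "m z \<noteq> x" "m z \<noteq> y" using out m by auto
          then show "of_bool (z \<in> ?W) - of_bool (m z \<in> ?W) = (of_bool (z \<in> W) - of_bool (m z \<in> W) :: real)"
            unfolding W' by auto
        qed
        ultimately show ?thesis using inv[OF out less.prems] by simp
      qed
    qed
  qed
qed

text \<open>Among the nonzero eigenfunctions for \<open>\<mu>\<close> that are antisymmetric under
  disjoint pairs, take one with the most pairs. Maximality gives invariance outside them, so it is a
  multiple of a pairing weight. The eigenvalue equation at a set where it is nonzero then gives the
  signed count, with \<open>k\<close> the number of pairs.\<close>

lemma johnson_eigenvalue_eq_signed_count:
  assumes X: "finite X" and "s \<le> r" and g: "johnson_eigenfunction X r s \<mu> g"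
    and nz: "S \<in> subsets_of_card X r" "g S \<noteq> 0"
  obtains k where "0 < k" "k \<le> r" "k \<le> card X - r" "\<mu> = signed_count k r (card X - r) s (r - s)"
proof -
  define P where "P c \<longleftrightarrow> (\<exists>Q m h S. card Q = c \<and> antisymmetric_on X r Q m h
     \<and> johnson_eigenfunction X r s \<mu> h \<and> S \<in> subsets_of_card X r \<and> h S \<noteq> 0)" for c
  (* P c: some eigenfunction is antisymmetric under c/2 disjoint transpositions. *)
  have "P 0" unfolding P_def using g nz
    by (intro exI[of _ "{}"] exI[of _ id] exI[of _ g] exI[of _ S]) (auto simp: antisymmetric_on_def)
  moreover have bound: "\<And>c. P c \<Longrightarrow> c \<le> card X"
    unfolding P_def antisymmetric_on_def using X by (auto intro: card_mono)
  ultimately have "P (Greatest P)" by (rule GreatestI_nat)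
  then obtain Q m h T where Q: "card Q = Greatest P" "antisymmetric_on X r Q m h"
    and h: "johnson_eigenfunction X r s \<mu> h" and T: "T \<in> subsets_of_card X r" "h T \<noteq> 0"
    unfolding P_def by blast
  have QX: "Q \<subseteq> X" using Q by (simp add: antisymmetric_on_def)
  have finQ: "finite Q" using QX X finite_subset by blast
  \<comment> \<open>Otherwise antisymmetrizing under \<open>transpose a b\<close> would leave a
    nonzero eigenfunction with one more pair.\<close>
  have inv: "h (transpose a b ` U) = h U"
    if ab: "a \<in> X - Q" "b \<in> X - Q" and U: "U \<in> subsets_of_card X r" for a b U
  proof (rule ccontr)
    assume neq: "\<not> ?thesis"
    then have "a \<noteq> b" by auto
    then have card: "card (insert a (insert b Q)) = Suc (Suc (Greatest P))"
      using ab finQ Q by simp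
    have "P (Suc (Suc (Greatest P)))" unfolding P_def[of "Suc _"]
    proof (intro exI conjI)
      show "antisymmetric_on X r (insert a (insert b Q)) (m(a := b, b := a))
           (\<lambda>S. h S - h (transpose a b ` S))"
        by (rule antisymmetric_on_extend[OF Q(2) ab \<open>a \<noteq> b\<close>])
      show "johnson_eigenfunction X r s \<mu> (\<lambda>S. h S - h (transpose a b ` S))"
        using h ab by (intro johnson_eigenfunction_antisymmetrize) auto
      show "h U - h (transpose a b ` U) \<noteq> 0" using neq by simp
      show "card (insert a (insert b Q)) = Suc (Suc (Greatest P))" by (rule card)
      show "U \<in> subsets_of_card X r" by (rule U)
    qed
    then have "Suc (Suc (Greatest P)) \<le> Greatest P" using bound by (rule Greatest_le_nat)
    then show False by simp
  qed
  let ?A = "Q \<inter> T"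
  have hW: "h W = h T * pairing_weight m ?A W" if "W \<in> subsets_of_card X r" for W
    using eq_pairing_weight[OF X Q(2) inv T that] by blast
  have TX: "T \<subseteq> X" "card T = r" "finite T" using T X by (auto simp: subsets_of_card_def intro: finite_subset)
  have m: "m x \<in> Q" "m (m x) = x" if "x \<in> Q" for x
    using Q that by (auto simp: antisymmetric_on_def)
  have mT: "m x \<notin> T" if "x \<in> ?A" for x
  proof
    assume "m x \<in> T"
    then have "transpose x (m x) ` T = T" using that by (intro transpose_image_eq) auto
    moreover have "h (transpose x (m x) ` T) = - h T"
      using Q(2) that T by (simp add: antisymmetric_on_def)
    ultimately show False using T by simp
  qed
  have inj: "inj_on m ?A" by (rule inj_onI) (metis IntD1 m(2))
  have mA: "m ` ?A \<subseteq> X - T" using mT m QX by auto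
  have cards: "card (X - T) = card X - r" using TX by (simp add: card_Diff_subset)
  have "\<mu> * h T = (\<Sum>W | W \<in> subsets_of_card X r \<and> card (T \<inter> W) = s. h W)"
    using h T by (simp add: johnson_eigenfunction_def)
  also have "\<dots> = (\<Sum>W | W \<in> subsets_of_card X r \<and> card (T \<inter> W) = s. h T * pairing_weight m ?A W)"
    by (intro sum.cong refl hW) simp
  also have "\<dots> = h T * (\<Sum>W | W \<in> subsets_of_card X r \<and> card (T \<inter> W) = s. pairing_weight m ?A W)"
    by (simp add: sum_distrib_left)
  also have "\<dots> = h T * signed_count (card ?A) r (card X - r) s (r - s)"
    unfolding sum_neighbours_eq[OF X T(1) \<open>s \<le> r\<close>]
    by (subst sum_pairing_weight) (use TX X mA inj cards in auto)
  finally have "\<mu> = signed_count (card ?A) r (card X - r) s (r - s)" using T by simp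
  moreover have "card ?A \<le> r" using TX by (metis card_mono inf_le2)
  moreover have "card ?A \<le> card X - r"
    using card_inj_on_le[OF inj mA] X cards by simp
  \<comment> \<open>Without pairs \<open>h\<close> would be a nonzero constant on the subsets, whose
    sum cannot be zero.\<close>
  moreover have "0 < card ?A"
  proof (rule ccontr)
    assume "\<not> ?thesis"
    then have "?A = {}" using TX by simp
    then have "h W = h T" if "W \<in> subsets_of_card X r" for W
      using hW[OF that] by (simp add: pairing_weight_def)
    then have "(\<Sum>S\<in>subsets_of_card X r. h S) = real (card (subsets_of_card X r)) * h T" by simp
    then have "card (subsets_of_card X r) = 0" using h T by (simp add: johnson_eigenfunction_def)
    then show False using T X by simp
  qed
  ultimately show thesis using that by blast
qed

subsection \<open>Splitting off the constant eigenvector\<close>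

text \<open>\<open>B\<close> is the action of \<open>M\<close> on the quotient by the constant
  vectors. Factoring the characteristic polynomial removes exactly one copy of \<open>d\<close> from
  the spectrum, also when \<open>d\<close> is a multiple eigenvalue. The general field allows use
  over both the reals and the complex numbers.\<close>

lemma char_poly_deflate:
  fixes M :: "'a :: field_char_0 mat"
  assumes M: "M \<in> carrier_mat (Suc n) (Suc n)"
    and sym: "\<And>i j. i < Suc n \<Longrightarrow> j < Suc n \<Longrightarrow> M $$ (i, j) = M $$ (j, i)"
    and row: "\<And>i. i < Suc n \<Longrightarrow> (\<Sum>j<Suc n. M $$ (i, j)) = d"
  obtains B where "B \<in> carrier_mat n n" "char_poly M = [:- d, 1:] * char_poly B"
    "\<And>\<mu>. eigenvalue B \<mu> \<Longrightarrow> \<exists>z. (\<exists>i<Suc n. z i \<noteq> 0) \<and> (\<Sum>i<Suc n. z i) = 0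
       \<and> (\<forall>i<Suc n. (\<Sum>j<Suc n. M $$ (i, j) * z j) = \<mu> * z i)"
proof -
  (* Conjugation by P, whose first column is the all-ones eigenvector. *)
  define B where "B = mat n n (\<lambda>(i, j). M $$ (Suc i, Suc j) - M $$ (0, Suc j))"
  define R where "R = mat 1 n (\<lambda>(i, j). M $$ (0, Suc j))"
  define D where "D = mat 1 1 (\<lambda>(i, j). d)"
  define M' where "M' = four_block_mat D R (0\<^sub>m n 1) B"
  define P :: "'a mat" where "P = mat (Suc n) (Suc n) (\<lambda>(i, j). if j = 0 \<or> i = j then 1 else 0)"
  define Q :: "'a mat" where
    "Q = mat (Suc n) (Suc n) (\<lambda>(i, j). if i = j then 1 else if j = 0 then - 1 else 0)"
  have carr: "B \<in> carrier_mat n n" "R \<in> carrier_mat 1 n" "D \<in> carrier_mat 1 1"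
    "P \<in> carrier_mat (Suc n) (Suc n)" "Q \<in> carrier_mat (Suc n) (Suc n)"
    by (simp_all add: B_def R_def D_def P_def Q_def)
  have M'carr: "M' \<in> carrier_mat (Suc n) (Suc n)"
    using carr by (auto simp: M'_def)
  have M'_ix: "M' $$ (i, j) = (if i = 0 then if j = 0 then d else M $$ (0, j)
      else if j = 0 then 0 else M $$ (i, j) - M $$ (0, j))" if "i < Suc n" "j < Suc n" for i j
    using that carr by (auto simp: M'_def B_def R_def D_def)
  have Psum: "(\<Sum>l<Suc n. P $$ (i, l) * f l) = (if i = 0 then f 0 else f 0 + f i)"
    if "i < Suc n" for i and f :: "nat \<Rightarrow> 'a"
  proof -
    have "(\<Sum>l<Suc n. P $$ (i, l) * f l)
        = (\<Sum>l<Suc n. (if l = 0 then f l else 0) + (if l = i then if i = 0 then 0 else f l else 0))"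
      using that by (intro sum.cong) (auto simp: P_def)
    then show ?thesis using that by (simp add: sum.distrib sum.delta del: sum.lessThan_Suc)
  qed
  have Qsum: "(\<Sum>l<Suc n. Q $$ (i, l) * f l) = (if i = 0 then f 0 else f i - f 0)"
    if "i < Suc n" for i and f :: "nat \<Rightarrow> 'a"
  proof -
    have "(\<Sum>l<Suc n. Q $$ (i, l) * f l)
        = (\<Sum>l<Suc n. (if l = i then f l else 0) - (if l = 0 then if i = 0 then 0 else f l else 0))"
      using that by (intro sum.cong) (auto simp: Q_def)
    then show ?thesis using that by (simp add: sum_subtractf sum.delta del: sum.lessThan_Suc)
  qed
  have prod_ix: "(A * C) $$ (i, j) = (\<Sum>l<Suc n. A $$ (i, l) * C $$ (l, j))"
    if "A \<in> carrier_mat (Suc n) (Suc n)" "C \<in> carrier_mat (Suc n) (Suc n)" "i < Suc n" "j < Suc n"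
    for A C :: "'a mat" and i j
    using that by (simp add: scalar_prod_def atLeast0LessThan del: sum.lessThan_Suc)
  have PQ: "P * Q = 1\<^sub>m (Suc n)"
  proof (rule eq_matI)
    fix i j assume "i < dim_row (1\<^sub>m (Suc n) :: 'a mat)" "j < dim_col (1\<^sub>m (Suc n) :: 'a mat)"
    then have ij: "i < Suc n" "j < Suc n" by simp_all
    show "(P * Q) $$ (i, j) = 1\<^sub>m (Suc n) $$ (i, j)"
      unfolding prod_ix[OF carr(4,5) ij] Psum[OF ij(1)] using ij by (auto simp: Q_def)
  qed (use carr in auto)
  have QP: "Q * P = 1\<^sub>m (Suc n)"
  proof (rule eq_matI)
    fix i j assume "i < dim_row (1\<^sub>m (Suc n) :: 'a mat)" "j < dim_col (1\<^sub>m (Suc n) :: 'a mat)"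
    then have ij: "i < Suc n" "j < Suc n" by simp_all
    show "(Q * P) $$ (i, j) = 1\<^sub>m (Suc n) $$ (i, j)"
      unfolding prod_ix[OF carr(5,4) ij] Qsum[OF ij(1)] using ij by (auto simp: P_def)
  qed (use carr in auto)
  have eq: "M * P = P * M'"
  proof (rule eq_matI)
    fix i j assume "i < dim_row (P * M')" "j < dim_col (P * M')"
    then have ij: "i < Suc n" "j < Suc n" using carr M'carr by auto
    have "(\<Sum>l<Suc n. M $$ (i, l) * P $$ (l, j)) = (if j = 0 then d else M $$ (i, j))"
    proof (cases j)
      case 0
      have "(\<Sum>l<Suc n. M $$ (i, l) * P $$ (l, j)) = (\<Sum>l<Suc n. M $$ (i, l))"
        using ij 0 by (intro sum.cong) (auto simp: P_def)
      then show ?thesis using row[OF ij(1)] 0 by simp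
    next
      case (Suc j')
      have "(\<Sum>l<Suc n. M $$ (i, l) * P $$ (l, j)) = (\<Sum>l<Suc n. if l = j then M $$ (i, l) else 0)"
        using ij Suc by (intro sum.cong) (auto simp: P_def)
      then show ?thesis using ij Suc by (simp add: sum.delta del: sum.lessThan_Suc)
    qed
    moreover have "(\<Sum>l<Suc n. P $$ (i, l) * M' $$ (l, j)) = (if j = 0 then d else M $$ (i, j))"
      using ij by (simp add: Psum M'_ix del: sum.lessThan_Suc)
    ultimately show "(M * P) $$ (i, j) = (P * M') $$ (i, j)"
      using ij M M'carr carr by (simp only: prod_ix)
  qed (use carr M M'carr in auto)
  have "M = M * (P * Q)" using PQ M by simp
  also have "\<dots> = P * M' * Q" unfolding eq[symmetric] by (rule assoc_mult_mat[OF M carr(4,5), symmetric])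
  finally have "similar_mat M M'"
    by (intro similar_matI[OF _ PQ QP]) (use M carr M'carr in auto)
  then have "char_poly M = char_poly M'" by (rule char_poly_similar)
  also have "\<dots> = char_poly D * char_poly B"
    unfolding M'_def by (rule char_poly_four_block_zeros_col[OF carr(3,2,1)])
  also have "char_poly D = [:- d, 1:]"
    by (subst char_poly_upper_triangular[OF carr(3)]) (auto simp: D_def diag_mat_def)
  finally have cp: "char_poly M = [:- d, 1:] * char_poly B" .
  have "\<exists>z. (\<exists>i<Suc n. z i \<noteq> 0) \<and> (\<Sum>i<Suc n. z i) = 0
       \<and> (\<forall>i<Suc n. (\<Sum>j<Suc n. M $$ (i, j) * z j) = \<mu> * z i)" if ev: "eigenvalue B \<mu>" for \<mu>
  proof -
    from ev obtain y where y: "y \<in> carrier_vec n" "y \<noteq> 0\<^sub>v n" "B *\<^sub>v y = \<mu> \<cdot>\<^sub>v y"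
      using carr unfolding eigenvalue_def eigenvector_def by auto
    \<comment> \<open>\<open>w\<close> lifts \<open>y\<close> from the quotient by a zero in
      coordinate 0, \<open>m\<close> is its mean, and \<open>c\<close> is the constant by which
      \<open>w\<close> fails to be an eigenvector of \<open>M\<close>.\<close>
    define w where "w i = (if i = 0 then 0 else y $ (i - 1))" for i
    define m where "m = (\<Sum>i<Suc n. w i) / of_nat (Suc n)"
    define c where "c = (\<Sum>j<n. M $$ (0, Suc j) * y $ j)"
    have w0: "w 0 = 0" "w (Suc i) = y $ i" for i by (simp_all add: w_def)
    have Mw: "(\<Sum>j<Suc n. M $$ (i, j) * w j) = \<mu> * w i + c" if "i < Suc n" for i
    proof (cases i)
      case 0
      then show ?thesis unfolding sum.lessThan_Suc_shift by (simp add: w0 c_def)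
    next
      case (Suc i')
      have "(B *\<^sub>v y) $ i' = (\<Sum>j<n. (M $$ (i, Suc j) - M $$ (0, Suc j)) * y $ j)"
        using that Suc y(1) by (simp add: B_def scalar_prod_def atLeast0LessThan)
      also have "\<dots> = (\<Sum>j<n. M $$ (i, Suc j) * y $ j) - c"
        by (simp add: left_diff_distrib sum_subtractf c_def)
      finally have "(\<Sum>j<n. M $$ (i, Suc j) * y $ j) = \<mu> * y $ i' + c"
        using y that Suc by simp
      then show ?thesis unfolding sum.lessThan_Suc_shift by (simp add: w0 Suc)
    qed
    \<comment> \<open>Summing over all rows determines \<open>c\<close>: by symmetry the column sums
      are \<open>d\<close> too, and the resulting \<open>c = (d - \<mu>) * m\<close> makes
      \<open>w - m\<close> an eigenvector.\<close>
    have "(\<Sum>i<Suc n. \<Sum>j<Suc n. M $$ (i, j) * w j) = (\<Sum>j<Suc n. (\<Sum>i<Suc n. M $$ (i, j)) * w j)"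
      by (subst sum.swap) (simp only: sum_distrib_right)
    also have "\<dots> = (\<Sum>j<Suc n. d * w j)"
    proof (intro sum.cong refl)
      fix j assume j: "j \<in> {..<Suc n}"
      have "(\<Sum>i<Suc n. M $$ (i, j)) = (\<Sum>i<Suc n. M $$ (j, i))"
        using j by (intro sum.cong refl sym) auto
      then show "(\<Sum>i<Suc n. M $$ (i, j)) * w j = d * w j" using j row[of j] by simp
    qed
    finally have 1: "(\<Sum>i<Suc n. \<mu> * w i + c) = d * (\<Sum>j<Suc n. w j)"
      using Mw by (simp add: sum_distrib_left del: sum.lessThan_Suc cong: sum.cong_simp)
    have "(\<Sum>i<Suc n. \<mu> * w i + c) = \<mu> * (\<Sum>j<Suc n. w j) + of_nat (Suc n) * c"
      by (simp only: sum.distrib sum_distrib_left) simp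
    with 1 have "of_nat (Suc n) * c = (d - \<mu>) * (\<Sum>j<Suc n. w j)" by (simp add: left_diff_distrib)
    moreover have nz: "(of_nat (Suc n) :: 'a) \<noteq> 0" by (metis of_nat_neq_0)
    ultimately have c: "c = (d - \<mu>) * m" by (simp add: m_def field_simps del: of_nat_Suc sum.lessThan_Suc)
    show ?thesis
    proof (intro exI[of _ "\<lambda>i. w i - m"] conjI allI impI)
      show "\<exists>i<Suc n. w i - m \<noteq> 0"
      proof (rule ccontr)
        assume "\<not> ?thesis"
        then have eq: "w i = m" if "i < Suc n" for i using that by auto
        then have "m = 0" using w0 by auto
        then have "y $ i = 0" if "i < n" for i using eq[of "Suc i"] that w0 by simp
        then have "y = 0\<^sub>v n" using y by (intro eq_vecI) auto
        with y show False by simp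
      qed
      show "(\<Sum>i<Suc n. w i - m) = 0"
        unfolding sum_subtractf sum_constant card_lessThan m_def
        using nz by (simp only: nonzero_mult_div_cancel_left times_divide_eq_right) simp
      fix i assume i: "i < Suc n"
      have "(\<Sum>j<Suc n. M $$ (i, j) * (w j - m)) = (\<Sum>j<Suc n. M $$ (i, j) * w j) - (\<Sum>j<Suc n. M $$ (i, j)) * m"
        by (simp only: right_diff_distrib sum_subtractf sum_distrib_right)
      then show "(\<Sum>j<Suc n. M $$ (i, j) * (w j - m)) = \<mu> * (w i - m)"
        unfolding Mw[OF i] row[OF i] c by (simp add: algebra_simps)
    qed
  qed
  with carr(1) cp that show thesis by blast
qed

text \<open>The Hermitian form \<open>q\<close> of \<open>M\<close> at \<open>z\<close> is its own
  conjugate and equals \<open>\<mu>\<close> times a positive real.\<close>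

lemma symmetric_eigenvalue_real:
  fixes M :: "nat \<Rightarrow> nat \<Rightarrow> real" and z :: "nat \<Rightarrow> complex"
  assumes sym: "\<And>i j. i < n \<Longrightarrow> j < n \<Longrightarrow> M i j = M j i"
    and nz: "\<exists>i<n. z i \<noteq> 0"
    and ev: "\<And>i. i < n \<Longrightarrow> (\<Sum>j<n. of_real (M i j) * z j) = \<mu> * z i"
  shows "\<mu> \<in> \<real>"
proof -
  define q where "q = (\<Sum>i<n. \<Sum>j<n. cnj (z i) * (of_real (M i j) * z j))"
  define S where "S = (\<Sum>i<n. (cmod (z i))\<^sup>2)"
  have "q = (\<Sum>i<n. \<mu> * of_real ((cmod (z i))\<^sup>2))"
    unfolding q_def
  proof (intro sum.cong refl)
    fix i assume "i \<in> {..<n}"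
    then show "(\<Sum>j<n. cnj (z i) * (of_real (M i j) * z j)) = \<mu> * of_real ((cmod (z i))\<^sup>2)"
      unfolding complex_norm_square sum_distrib_left[symmetric] by (simp add: ev)
  qed
  then have q: "q = \<mu> * of_real S" by (simp add: S_def sum_distrib_left)
  have "cnj q = (\<Sum>i<n. \<Sum>j<n. cnj (z j) * (of_real (M i j) * z i))"
    by (simp add: q_def mult_ac)
  also have "\<dots> = q" unfolding q_def
    by (subst sum.swap) (intro sum.cong refl, simp add: sym)
  finally have "cnj \<mu> * of_real S = \<mu> * of_real S" by (simp add: q)
  moreover have "S > 0"
  proof -
    obtain i where "i < n" "z i \<noteq> 0" using nz by auto
    then show ?thesis unfolding S_def by (intro sum_pos2[of _ i]) auto
  qed
  ultimately have "cnj \<mu> = \<mu>" by simp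
  then show ?thesis by (simp add: Reals_cnj_iff)
qed

text \<open>\<open>K\<close> stands for the spectrum with one copy of the degree removed;
  \<open>d\<close> need not be the largest entry. If \<open>d\<close> comes second, the entry above
  it lies in \<open>K\<close> and is at most \<open>b\<close>; if \<open>d\<close> comes last,
  \<open>d \<ge> 0\<close> bounds it from below.\<close>

lemma rev_sorted_list_of_multiset_bound:
  fixes K :: "real multiset" and d :: real
  assumes "0 \<le> d" "K \<noteq> {#}" "\<And>x. x \<in># K \<Longrightarrow> \<bar>x\<bar> \<le> b"
  defines "xs \<equiv> rev (sorted_list_of_multiset (add_mset d K))"
  shows "\<bar>max (xs ! 1) (- last xs)\<bar> \<le> b"
proof -
  define ys where "ys = sorted_list_of_multiset (add_mset d K)"
  have ys: "mset ys = add_mset d K" "sorted ys" by (simp_all only: ys_def mset_sorted_list_of_multiset sorted_sorted_list_of_multiset)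
  have len: "length ys = Suc (size K)" using ys(1) by (metis size_add_mset size_mset)
  have K: "size K > 0" using assms(2) by (simp add: nonempty_has_size)
  have mem: "x = d \<or> x \<in># K" if "x \<in> set ys" for x
    using that ys(1) by (metis set_mset_add_mset_insert insert_iff set_mset_mset)
  have sec: "xs ! 1 = ys ! (length ys - 2)"
    unfolding xs_def ys_def[symmetric] using len K by (subst rev_nth) auto
  have fin: "last xs = ys ! 0"
    unfolding xs_def ys_def[symmetric] using len by (simp add: last_rev hd_conv_nth flip: length_0_conv)
  have le: "ys ! 0 \<le> ys ! (length ys - 2)" using ys(2) len K by (intro sorted_nth_mono) auto
  obtain u zs where uz: "ys = zs @ [u]" using len by (cases ys rule: rev_cases) auto
  obtain v ws where vw: "zs = ws @ [v]" using len K uz by (cases zs rule: rev_cases) auto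
  have v: "ys ! (length ys - 2) = v" using uz vw by (simp add: nth_append)
  have vu: "v \<le> u" using ys(2) uz vw by (simp add: sorted_append)
  have upper: "v \<le> b"
  proof (cases "v \<in># K")
    case True then show ?thesis using assms(3)[of v] by simp
  next
    case False
    then have "v = d" using mem uz vw by auto
    then have "u \<in># K" using ys(1) uz vw by auto
    then show ?thesis using assms(3)[of u] vu by simp
  qed
  obtain x where x: "x \<in># K" using assms(2) by blast
  then have b: "0 \<le> b" using assms(3)[of x] by linarith
  have "ys ! 0 = d \<or> ys ! 0 \<in># K" using len by (intro mem nth_mem) simp
  then have "- b \<le> ys ! 0" using assms(1,3) b by (smt (verit))
  then show ?thesis using upper le b unfolding sec fin v by linarith
qed

subsection \<open>The second eigenvalue of the Johnson graph\<close>

lemma card_neighbours: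
  assumes "finite X" "S \<in> subsets_of_card X r" "s \<le> r"
  shows "card {W \<in> subsets_of_card X r. card (S \<inter> W) = s} = (r choose s) * ((card X - r) choose (r - s))"
proof -
  have S: "S \<subseteq> X" "card S = r" "finite S"
    using assms by (auto simp: subsets_of_card_def intro: finite_subset)
  have "real (card {W \<in> subsets_of_card X r. card (S \<inter> W) = s})
      = real ((r choose s) * ((card X - r) choose (r - s)))"
    using sum_neighbours_eq[OF assms, of "\<lambda>_. 1"] S assms(1)
    by (simp add: card_subsets_of_card card_Diff_subset)
  then show ?thesis by (simp only: of_nat_eq_iff)
qed

definition support_set :: "nat \<Rightarrow> real vec \<Rightarrow> nat set" where
  "support_set n v = {i. i < n \<and> v $ i = 1}"

lemma scalar_prod_support_set:
  assumes "v \<in> carrier_vec n" "w \<in> carrier_vec n" "\<forall>i<n. v $ i \<in> {0, 1}" "\<forall>i<n. w $ i \<in> {0, 1}"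
  shows "v \<bullet> w = real (card (support_set n v \<inter> support_set n w))"
proof -
  have "v \<bullet> w = (\<Sum>i<n. v $ i * w $ i)"
    using assms(2) by (simp add: scalar_prod_def atLeast0LessThan)
  also have "\<dots> = (\<Sum>i<n. if i \<in> support_set n v \<inter> support_set n w then 1 else 0)"
    using assms(3,4) by (intro sum.cong refl) (auto simp: support_set_def)
  also have "\<dots> = real (card ({..<n} \<inter> (support_set n v \<inter> support_set n w)))"
    by (subst sum.inter_restrict[symmetric]) simp_all
  also have "{..<n} \<inter> (support_set n v \<inter> support_set n w) = support_set n v \<inter> support_set n w"
    by (auto simp: support_set_def)
  finally show ?thesis .
qed

lemma johnson_scalar_prod:
  assumes "v \<in> johnson_vertices n r" "w \<in> johnson_vertices n r"
  shows "v \<bullet> w = real (card (support_set n v \<inter> support_set n w))"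
  using assms by (intro scalar_prod_support_set) (auto simp: johnson_vertices_def)

lemma bij_betw_support_set:
  "bij_betw (support_set n) (johnson_vertices n r) (subsets_of_card {..<n} r)"
proof (rule bij_betwI[of _ _ _ "\<lambda>S. vec n (\<lambda>i. of_bool (i \<in> S))"])
  show "support_set n \<in> johnson_vertices n r \<rightarrow> subsets_of_card {..<n} r"
  proof
    fix v assume v: "v \<in> johnson_vertices n r"
    then have "real r = real (card (support_set n v))"
      using johnson_scalar_prod[OF v v] by (simp add: johnson_vertices_def)
    then show "support_set n v \<in> subsets_of_card {..<n} r"
      by (auto simp: subsets_of_card_def support_set_def)
  qed
  have supp: "support_set n (vec n (\<lambda>i. of_bool (i \<in> S))) = S" if "S \<subseteq> {..<n}" for S
    using that by (auto simp: support_set_def)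
  then show "support_set n (vec n (\<lambda>i. of_bool (i \<in> S))) = S" if "S \<in> subsets_of_card {..<n} r" for S
    using that by (simp add: subsets_of_card_def)
  show "(\<lambda>S. vec n (\<lambda>i. of_bool (i \<in> S))) \<in> subsets_of_card {..<n} r \<rightarrow> johnson_vertices n r"
  proof
    fix S assume "S \<in> subsets_of_card {..<n} r"
    then have S: "S \<subseteq> {..<n}" "card S = r" by (auto simp: subsets_of_card_def)
    have "vec n (\<lambda>i. of_bool (i \<in> S)) \<bullet> vec n (\<lambda>i. of_bool (i \<in> S)) = real r"
      by (subst scalar_prod_support_set[of _ n]) (use S in \<open>auto simp: supp\<close>)
    then show "vec n (\<lambda>i. of_bool (i \<in> S)) \<in> johnson_vertices n r"
      by (simp add: johnson_vertices_def)
  qed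
  show "vec n (\<lambda>i. of_bool (i \<in> support_set n v)) = v" if "v \<in> johnson_vertices n r" for v
    using that by (intro eq_vecI) (auto simp: johnson_vertices_def support_set_def)
qed

lemma pverts_johnson_graph [simp]: "pverts (johnson_graph n r s) = johnson_vertices n r"
  by (simp add: johnson_graph_def)

text \<open>The hypothesis \<open>s < r\<close> makes the condition \<open>v \<noteq> w\<close> in the definition of the graph vacuous.\<close>

lemma johnson_arc_iff:
  assumes "s < r" "v \<in> johnson_vertices n r" "w \<in> johnson_vertices n r"
  shows "(v, w) \<in> parcs (johnson_graph n r s) \<longleftrightarrow> card (support_set n v \<inter> support_set n w) = s"
proof -
  have "card (support_set n v) = r"
    using bij_betw_apply[OF bij_betw_support_set assms(2)] by (simp add: subsets_of_card_def)
  then show ?thesis using assms by (auto simp: johnson_graph_def johnson_scalar_prod)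
qed

lemma out_degree_johnson_graph:
  assumes "s < r" "v \<in> johnson_vertices n r"
  shows "out_degree (with_proj (johnson_graph n r s)) v = (r choose s) * ((n - r) choose (r - s))"
proof -
  let ?N = "{W \<in> subsets_of_card {..<n} r. card (support_set n v \<inter> W) = s}"
  have v: "support_set n v \<in> subsets_of_card {..<n} r"
    using bij_betw_apply[OF bij_betw_support_set assms(2)] .
  have inj: "inj_on (support_set n) (johnson_vertices n r)"
    and img: "support_set n ` johnson_vertices n r = subsets_of_card {..<n} r"
    using bij_betw_support_set by (auto simp: bij_betw_def)
  have "out_arcs (with_proj (johnson_graph n r s)) v
      = Pair v ` {w \<in> johnson_vertices n r. card (support_set n v \<inter> support_set n w) = s}"
    using assms johnson_arc_iff[OF assms(1)]
    by (auto simp: out_arcs_def) (auto simp: johnson_graph_def)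
  then have "out_degree (with_proj (johnson_graph n r s)) v
      = card {w \<in> johnson_vertices n r. card (support_set n v \<inter> support_set n w) = s}"
    by (simp add: out_degree_def card_image inj_on_def)
  also have "\<dots> = card (support_set n ` {w \<in> johnson_vertices n r. card (support_set n v \<inter> support_set n w) = s})"
    by (rule card_image[symmetric]) (use inj in \<open>auto intro: inj_on_subset\<close>)
  also have "support_set n ` {w \<in> johnson_vertices n r. card (support_set n v \<inter> support_set n w) = s} = ?N"
    unfolding img[symmetric] by auto
  also have "card ?N = (r choose s) * ((n - r) choose (r - s))"
    using card_neighbours[of "{..<n}"] v assms(1) by simp
  finally show ?thesis .
qed

lemma common_degree_johnson_graph:
  assumes "s < r" "r \<le> n"
  shows "common_degree (johnson_graph n r s) = (r choose s) * ((n - r) choose (r - s))"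
proof -
  have "{..<r} \<in> subsets_of_card {..<n} r" using assms by (auto simp: subsets_of_card_def)
  then obtain v where v: "v \<in> johnson_vertices n r"
    using bij_betw_support_set unfolding bij_betw_def by (metis imageE)
  show ?thesis unfolding common_degree_def
    by (rule the_equality)
       (use v out_degree_johnson_graph[OF assms(1)] in auto)
qed

lemma adjacency_matrix_johnson_graph:
  assumes "s < r"
  obtains N e where "N = n choose r" "bij_betw e {..<N} (subsets_of_card {..<n} r)"
    "adjacency_matrix (johnson_graph n r s) \<in> carrier_mat N N"
    "\<And>i j. i < N \<Longrightarrow> j < N \<Longrightarrow>
       adjacency_matrix (johnson_graph n r s) $$ (i, j) = of_bool (card (e i \<inter> e j) = s)"
proof -
  define vs where "vs = vertex_list (johnson_graph n r s)"
  have "\<exists>vs. distinct vs \<and> set vs = pverts (johnson_graph n r s)"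
    using finite_distinct_list[OF finite_johnson_vertices[of n r]] by auto
  then have "distinct vs \<and> set vs = pverts (johnson_graph n r s)"
    unfolding vs_def vertex_list_def by (rule someI_ex)
  then have vs: "distinct vs" "set vs = johnson_vertices n r" by simp_all
  have bij: "bij_betw (support_set n \<circ> (!) vs) {..<length vs} (subsets_of_card {..<n} r)"
    using vs by (intro bij_betw_trans[OF _ bij_betw_support_set] bij_betw_nth) auto
  have len: "length vs = n choose r"
    using bij_betw_same_card[OF bij] by (simp add: card_subsets_of_card)
  have mem: "vs ! i \<in> johnson_vertices n r" if "i < length vs" for i
    using that vs nth_mem by blast
  have M: "adjacency_matrix (johnson_graph n r s)
    = mat (length vs) (length vs) (\<lambda>(i, j). if (vs ! i, vs ! j) \<in> parcs (johnson_graph n r s) then 1 else 0)"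
    by (simp add: adjacency_matrix_def vs_def Let_def)
  show thesis
    by (rule that[OF len bij]) (simp_all add: M johnson_arc_iff[OF assms mem mem])
qed

text \<open>After one copy of the degree is split off, each remaining eigenvalue has an eigenvector
  of sum zero, hence is a signed count with \<open>k > 0\<close>.\<close>

lemma graph_lambda_johnson_graph_le:
  fixes b :: real
  assumes sr: "s < r" and N2: "2 \<le> n choose r"
    and bound: "\<And>k. \<lbrakk>0 < k; k \<le> r; k \<le> n - r\<rbrakk> \<Longrightarrow> \<bar>signed_count k r (n - r) s (r - s)\<bar> \<le> b"
  shows "\<bar>graph_lambda (johnson_graph n r s)\<bar> \<le> b"
proof -
  define M where "M = adjacency_matrix (johnson_graph n r s)"
  define d where "d = real ((r choose s) * ((n - r) choose (r - s)))"
  obtain N e where N: "N = n choose r" and bij: "bij_betw e {..<N} (subsets_of_card {..<n} r)"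
    and M: "M \<in> carrier_mat N N"
    and Mix: "\<And>i j. i < N \<Longrightarrow> j < N \<Longrightarrow> M $$ (i, j) = of_bool (card (e i \<inter> e j) = s)"
    using adjacency_matrix_johnson_graph[OF sr, of n] unfolding M_def by blast
  \<comment> \<open>There are at least two vertices, so the deflated matrix \<open>B\<close> has
    positive size and a second eigenvalue can exist.\<close>
  obtain N' where N': "N = Suc N'" "0 < N'" using that[of "N - 1"] N N2 by auto
  note M = M[unfolded N'] and Mix = Mix[unfolded N'] and bij = bij[unfolded N']
  have Msum: "(\<Sum>j<Suc N'. M $$ (i, j) * h (e j))
      = (\<Sum>W | W \<in> subsets_of_card {..<n} r \<and> card (e i \<inter> W) = s. h W)" if "i < Suc N'" for i h
  proof -
    have "(\<Sum>j<Suc N'. M $$ (i, j) * h (e j)) = (\<Sum>j<Suc N'. of_bool (card (e i \<inter> e j) = s) * h (e j))"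
      using that by (intro sum.cong refl) (simp add: Mix)
    also have "\<dots> = (\<Sum>W\<in>subsets_of_card {..<n} r. of_bool (card (e i \<inter> W) = s) * h W)"
      by (rule sum.reindex_bij_betw[OF bij])
    also have "\<dots> = (\<Sum>W\<in>subsets_of_card {..<n} r. if card (e i \<inter> W) = s then h W else 0)"
      by (intro sum.cong) auto
    also have "\<dots> = (\<Sum>W | W \<in> subsets_of_card {..<n} r \<and> card (e i \<inter> W) = s. h W)"
      by (simp add: sum.inter_filter)
    finally show ?thesis .
  qed
  have e: "e i \<in> subsets_of_card {..<n} r" if "i < Suc N'" for i
    using bij_betw_apply[OF bij] that by simp
  have row: "(\<Sum>j<Suc N'. M $$ (i, j)) = d" if "i < Suc N'" for i
    using Msum[OF that, of "\<lambda>_. 1"] card_neighbours[OF _ e[OF that], of s] sr by (simp add: d_def)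
  have sym: "M $$ (i, j) = M $$ (j, i)" if "i < Suc N'" "j < Suc N'" for i j
    using that by (simp add: Mix Int_commute)
  obtain B where B: "B \<in> carrier_mat N' N'" "char_poly M = [:- d, 1:] * char_poly B"
    and evB: "\<And>\<mu>. eigenvalue B \<mu> \<Longrightarrow> \<exists>z. (\<exists>i<Suc N'. z i \<noteq> 0) \<and> (\<Sum>i<Suc N'. z i) = 0
       \<and> (\<forall>i<Suc N'. (\<Sum>j<Suc N'. M $$ (i, j) * z j) = \<mu> * z i)"
    by (rule char_poly_deflate[OF M sym row]) (assumption+, rule that)
  have B0: "char_poly B \<noteq> 0" using degree_monic_char_poly[OF B(1)] by auto
  have roots: "x \<in># proots (char_poly B) \<longleftrightarrow> eigenvalue B x" for x
    using B0 by (simp add: eigenvalue_root_char_poly[OF B(1)])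
  have le: "\<bar>x\<bar> \<le> b" if x: "x \<in># proots (char_poly B)" for x
  proof -
    obtain z i where z: "i < Suc N'" "z i \<noteq> 0" "(\<Sum>i<Suc N'. z i) = 0"
      "\<And>i. i < Suc N' \<Longrightarrow> (\<Sum>j<Suc N'. M $$ (i, j) * z j) = x * z i"
      using evB x roots by blast
    define g where "g W = z (inv_into {..<Suc N'} e W)" for W
    have ge: "g (e i) = z i" if "i < Suc N'" for i
      unfolding g_def using that bij by (subst inv_into_f_f) (auto simp: bij_betw_def)
    have "johnson_eigenfunction {..<n} r s x g"
      unfolding johnson_eigenfunction_def
    proof (intro conjI ballI)
      have "(\<Sum>S\<in>subsets_of_card {..<n} r. g S) = (\<Sum>i<Suc N'. g (e i))"
        by (rule sum.reindex_bij_betw[OF bij, symmetric])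
      also have "\<dots> = (\<Sum>i<Suc N'. z i)" by (intro sum.cong refl) (simp add: ge)
      finally show "(\<Sum>S\<in>subsets_of_card {..<n} r. g S) = 0" using z(3) by simp
      fix S assume "S \<in> subsets_of_card {..<n} r"
      then obtain i where i: "i < Suc N'" "S = e i"
        using bij unfolding bij_betw_def by (metis imageE lessThan_iff)
      have "(\<Sum>j<Suc N'. M $$ (i, j) * g (e j)) = (\<Sum>j<Suc N'. M $$ (i, j) * z j)"
        by (intro sum.cong refl) (simp add: ge)
      then show "(\<Sum>W | W \<in> subsets_of_card {..<n} r \<and> card (S \<inter> W) = s. g W) = x * g S"
        using Msum[OF i(1), of g] z(4)[OF i(1)] ge[OF i(1)] i(2) by simp
    qed
    moreover have "g (e i) \<noteq> 0" using ge z by simp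
    ultimately obtain k where "0 < k" "k \<le> r" "k \<le> card {..<n} - r"
        "x = signed_count k r (card {..<n} - r) s (r - s)"
      using johnson_eigenvalue_eq_signed_count[of "{..<n}" s r x g "e i"] sr e z(1) by auto
    then show ?thesis using bound[of k] by simp
  qed
  \<comment> \<open>Here \<open>proots\<close> sees only real roots, so a real root has to be
    produced: the same deflation over the complex numbers yields a root, which is real because
    \<open>M\<close> is symmetric.\<close>
  have "proots (char_poly B) \<noteq> {#}"
  proof -
    interpret of_real_poly: map_poly_comm_ring_hom "of_real :: real \<Rightarrow> complex" ..
    let ?C = "map_mat complex_of_real M"
    have C: "?C \<in> carrier_mat (Suc N') (Suc N')" using M by simp
    have Cix: "?C $$ (i, j) = of_real (M $$ (i, j))" if "i < Suc N'" "j < Suc N'" for i j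
      using that M by simp
    have Crow: "(\<Sum>j<Suc N'. ?C $$ (i, j)) = of_real d" if "i < Suc N'" for i
    proof -
      have "(\<Sum>j<Suc N'. ?C $$ (i, j)) = of_real (\<Sum>j<Suc N'. M $$ (i, j))"
        unfolding of_real_sum using that by (intro sum.cong refl) (simp add: Cix)
      then show ?thesis by (simp only: row[OF that])
    qed
    have Csym: "?C $$ (i, j) = ?C $$ (j, i)" if "i < Suc N'" "j < Suc N'" for i j
      using sym[OF that] that by (simp add: Cix)
    obtain B' where B': "B' \<in> carrier_mat N' N'" "char_poly ?C = [:- of_real d, 1:] * char_poly B'"
      and evB': "\<And>\<mu>. eigenvalue B' \<mu> \<Longrightarrow> \<exists>z. (\<exists>i<Suc N'. z i \<noteq> 0) \<and> (\<Sum>i<Suc N'. z i) = 0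
         \<and> (\<forall>i<Suc N'. (\<Sum>j<Suc N'. ?C $$ (i, j) * z j) = \<mu> * z i)"
      by (rule char_poly_deflate[OF C Csym Crow]) (assumption+, rule that)
    have "char_poly ?C = map_poly of_real (char_poly M)" by (rule of_real_hom.char_poly_hom[OF M])
    also have "\<dots> = [:- of_real d, 1:] * map_poly of_real (char_poly B)"
      unfolding B(2) of_real_poly.hom_mult by (simp add: hom_distribs)
    finally have eq: "char_poly B' = map_poly of_real (char_poly B)"
      unfolding B'(2) by (subst (asm) mult_cancel_left) auto
    have "\<not> constant (poly (char_poly B'))"
      using degree_monic_char_poly[OF B'(1)] N' by (simp add: constant_degree)
    then obtain \<mu> where \<mu>: "poly (char_poly B') \<mu> = 0"
      using fundamental_theorem_of_algebra by blast
    then have "eigenvalue B' \<mu>" by (simp add: eigenvalue_root_char_poly[OF B'(1)])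
    then obtain z where z: "\<exists>i<Suc N'. z i \<noteq> 0"
        "\<And>i. i < Suc N' \<Longrightarrow> (\<Sum>j<Suc N'. ?C $$ (i, j) * z j) = \<mu> * z i"
      using evB' by blast
    have "\<mu> \<in> \<real>"
    proof (rule symmetric_eigenvalue_real[of "Suc N'" "\<lambda>i j. M $$ (i, j)" z])
      fix i assume i: "i < Suc N'"
      have "(\<Sum>j<Suc N'. of_real (M $$ (i, j)) * z j) = (\<Sum>j<Suc N'. ?C $$ (i, j) * z j)"
        using i by (intro sum.cong refl) (simp add: Cix)
      then show "(\<Sum>j<Suc N'. of_real (M $$ (i, j)) * z j) = \<mu> * z i" using z(2)[OF i] by simp
    qed (use z(1) sym in auto)
    then obtain x where "\<mu> = of_real x" by (auto elim: Reals_cases)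
    then have "poly (char_poly B) x = 0" using \<mu> eq by simp
    then have "x \<in># proots (char_poly B)" using B0 by simp
    then show ?thesis by auto
  qed
  then have "\<bar>max (rev (sorted_list_of_multiset (add_mset d (proots (char_poly B)))) ! 1)
      (- last (rev (sorted_list_of_multiset (add_mset d (proots (char_poly B))))))\<bar> \<le> b"
    using le by (intro rev_sorted_list_of_multiset_bound) (simp_all add: d_def)
  moreover have "proots (char_poly M) = add_mset d (proots (char_poly B))"
    unfolding B(2) by (subst proots_mult) (use B0 in simp_all)
  ultimately show ?thesis
    by (simp only: graph_lambda_def graph_eigenvalues_def flip: M_def)
qed

section \<open>Choice of constants and the asymptotic estimate\<close>

theorem theorem3:
  fixes \<alpha> :: real and f_r f_s :: "nat \<Rightarrow> real" and r s :: "nat \<Rightarrow> nat"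
  assumes "0 < \<alpha>" and "\<alpha> < 1"
    and "f_r \<in> o(\<lambda>n. real n)" and "f_s \<in> o(\<lambda>n. real n)"
    and "\<And>n. real (r n) = \<alpha> * real n + f_r n"
    and "\<And>n. real (s n) = \<alpha>\<^sup>2 * real n + f_s n"
  shows "(\<lambda>n. graph_lambda (johnson_graph n (r n) (s n))) \<in>
    O(\<lambda>n. max 1 (max \<bar>f_s n - 2 * \<alpha> * f_r n\<bar> ((f_r n)\<^sup>2 / real n)) / real n
          * real (common_degree (johnson_graph n (r n) (s n))))"
proof -
  (* Small enough that m = floor (e n) pairs can be revealed with densities staying in [e, 1 - e]. *)
  define e where "e = \<alpha>\<^sup>2 * (1 - \<alpha>) / 4"
  \<comment> \<open>Eventually \<open>\<kappa>\<close> times the square of \<open>n\<close> bounds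
    \<open>r n * (n - r n)\<close> from below.\<close>
  define \<kappa> where "\<kappa> = (\<alpha> - e) * (1 - \<alpha> - e)"
  have a2: "0 < \<alpha>\<^sup>2" "\<alpha>\<^sup>2 < \<alpha>" using assms(1,2) by (simp_all add: power2_eq_square)
  have e0: "0 < e" using assms(1,2) by (simp add: e_def)
  \<comment> \<open>The ratios \<open>s n / n\<close> and \<open>r n / n\<close> tend to
    \<open>\<alpha>\<^sup>2\<close> and \<open>\<alpha>\<close>. The next three bounds fit
    \<open>4 * e\<close> into each gap of \<open>0 < \<alpha>\<^sup>2 < \<alpha> < 1\<close>,
    leaving room for the errors and for \<open>m\<close> reveals.\<close>
  have e1: "4 * e \<le> \<alpha>\<^sup>2"
    using mult_left_mono[of "1 - \<alpha>" 1 "\<alpha>\<^sup>2"] assms(1) by (simp add: e_def)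
  have e2: "4 * e \<le> \<alpha> - \<alpha>\<^sup>2"
  proof -
    have "4 * e = \<alpha>\<^sup>2 * (1 - \<alpha>)" by (simp add: e_def)
    also have "\<dots> \<le> \<alpha> * (1 - \<alpha>)" using a2 assms(2) by (intro mult_right_mono) auto
    finally show ?thesis by (simp add: algebra_simps power2_eq_square)
  qed
  have e3: "4 * e < 1 - \<alpha>"
    using mult_strict_right_mono[of "\<alpha>\<^sup>2" 1 "1 - \<alpha>"] assms(2) a2 by (simp add: e_def)
  have \<kappa>: "0 < \<kappa>" unfolding \<kappa>_def using e0 e1 e3 a2 by (intro mult_pos_pos) linarith+
  have "\<forall>\<^sub>F n in at_top. \<bar>f_r n\<bar> \<le> e * real n"
    using landau_o.smallD[OF assms(3) e0] by simp
  moreover have "\<forall>\<^sub>F n in at_top. \<bar>f_s n\<bar> \<le> e * real n"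
    using landau_o.smallD[OF assms(4) e0] by simp
  \<comment> \<open>For such \<open>n\<close>, \<open>e * n\<close> is at least 2, so rounding it
    down to \<open>m\<close> loses at most half.\<close>
  moreover have "\<forall>\<^sub>F n in at_top. 2 / e \<le> real n"
    by (metis eventually_at_top_linorder nat_ceiling_le_eq)
  \<comment> \<open>In the constant, \<open>2 / \<kappa>\<close> comes from the density difference
    and \<open>4 / e\<^sup>2\<close> from the drift.\<close>
  ultimately have "\<forall>\<^sub>F n in at_top. norm (graph_lambda (johnson_graph n (r n) (s n)))
      \<le> (2 / \<kappa> + 4 / e\<^sup>2) * norm (max 1 (max \<bar>f_s n - 2 * \<alpha> * f_r n\<bar> ((f_r n)\<^sup>2 / real n)) / real n
          * real (common_degree (johnson_graph n (r n) (s n))))"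
  proof eventually_elim
    case (elim n)
    define m where "m = nat \<lfloor>e * real n\<rfloor>"
    define Mx where "Mx = max 1 (max \<bar>f_s n - 2 * \<alpha> * f_r n\<bar> ((f_r n)\<^sup>2 / real n))"
    define D where "D = real (r n choose s n) * real ((n - r n) choose (r n - s n))"
    have en: "2 \<le> e * real n" using elim(3) e0 by (simp add: field_simps)
    have n: "0 < real n" using en e0 by (metis mult_zero_right not_numeral_le_zero of_nat_0_less_iff of_nat_0 gr0I)
    have m: "e * real n / 2 \<le> real m" "real m \<le> e * real n" "0 < m"
      using en unfolding m_def by linarith+
    have r: "(\<alpha> - e) * real n \<le> real (r n)" "real (r n) \<le> (\<alpha> + e) * real n"
      using elim(1) assms(5)[of n] by (auto simp: algebra_simps)
    have s: "(\<alpha>\<^sup>2 - e) * real n \<le> real (s n)" "real (s n) \<le> (\<alpha>\<^sup>2 + e) * real n"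
      using elim(2) assms(6)[of n] by (auto simp: algebra_simps)
    have scale: "x * real n \<le> y * real n" if "x \<le> y" for x y using that n by simp
    have scale_less: "x * real n < y * real n" if "x < y" for x y using that n by simp
    have r_less: "real (r n) < real n" using r(2) scale_less[of "\<alpha> + e" 1] e0 e3 by simp
    then have rn: "real (n - r n) = real n - real (r n)" by simp
    have nr: "(1 - \<alpha> - e) * real n \<le> real (n - r n)" unfolding rn using r(2) by (simp add: algebra_simps)
    have mr: "2 * m < r n"
    proof -
      have "2 * e * real n < (\<alpha> - e) * real n" using e0 e1 a2 by (intro scale_less) linarith
      then have "2 * real m < real (r n)" using m(2) r(1) by linarith
      then show ?thesis by linarith
    qed
    have mnr: "2 * m < n - r n"
    proof -
      have "2 * e * real n < (1 - \<alpha> - e) * real n" using e0 e3 by (intro scale_less) linarith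
      then have "2 * real m < real (n - r n)" using m(2) nr by linarith
      then show ?thesis by linarith
    qed
    \<comment> \<open>With \<open>upper\<close>, this keeps the density inside a vertex between
      \<open>e\<close> and \<open>1 - e\<close> through \<open>m\<close> reveals.\<close>
    have lower: "e * real (r n) + real m \<le> real (s n)"
    proof -
      have "e * real (r n) \<le> e * real n" using r_less e0 by simp
      moreover have "2 * e * real n \<le> (\<alpha>\<^sup>2 - e) * real n" using e0 e1 by (intro scale) linarith
      ultimately show ?thesis using m(2) s(1) by linarith
    qed
    have upper: "real (s n) \<le> (1 - e) * (real (r n) - real m)"
    proof -
      have "(1 - e) * (real (r n) - real m) = real (r n) - real m - e * (real (r n) - real m)"
        by (simp add: algebra_simps)
      moreover have "e * (real (r n) - real m) \<le> e * real n"
        using r_less e0 by (intro mult_left_mono) auto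
      moreover have "(\<alpha>\<^sup>2 + e) * real n \<le> (\<alpha> - e - 2 * e) * real n"
        using e2 by (intro scale) linarith
      moreover have "(\<alpha> - e - 2 * e) * real n = (\<alpha> - e) * real n - 2 * (e * real n)"
        by (simp add: algebra_simps)
      ultimately show ?thesis using m(2) s(2) r(1) by linarith
    qed
    have sr: "s n < r n"
    proof -
      have "(1 - e) * (real (r n) - real m) \<le> 1 * (real (r n) - real m)"
        using mr e0 by (intro mult_right_mono) auto
      then have "real (s n) \<le> real (r n) - real m" using upper by (simp only: mult_1)
      then show ?thesis using m(3) by linarith
    qed
    have deg: "real (common_degree (johnson_graph n (r n) (s n))) = D"
      using common_degree_johnson_graph[OF sr] r_less by (simp add: D_def)
    have "2 \<le> n choose r n"
    proof -
      \<comment> \<open>Since \<open>0 < r n < n\<close>, the lower bound exceeds 1, so there are at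
        least two vertices.\<close>
      have "1 < (real n / real (r n)) ^ r n" using r_less sr by (intro one_less_power) auto
      also have "\<dots> \<le> real (n choose r n)" using r_less by (intro binomial_ge_n_over_k_pow_k) simp
      finally show ?thesis by linarith
    qed
    then have "\<bar>graph_lambda (johnson_graph n (r n) (s n))\<bar>
        \<le> (\<bar>real (s n) / real (r n) - real (r n - s n) / real (n - r n)\<bar> + 2 / (e * m)) * D"
      unfolding D_def using e0 e3 assms(1) m(3) mr mnr lower upper
      by (intro graph_lambda_johnson_graph_le[OF sr] signed_count_bound) auto
    also have "\<dots> \<le> ((2 / \<kappa> + 4 / e\<^sup>2) * (Mx / real n)) * D"
    proof (rule mult_right_mono)
      have pos: "0 < real (r n)" "0 < real (n - r n)" using mr mnr by auto
      have "real (s n) / real (r n) - real (r n - s n) / real (n - r n)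
          = (real (s n) * real n - (real (r n))\<^sup>2) / (real (r n) * real (n - r n))"
        using pos sr by (simp add: rn field_simps power2_eq_square of_nat_diff)
      \<comment> \<open>The terms \<open>\<alpha>\<^sup>2 * n\<^sup>2\<close> cancel, which is what
        makes the density difference small.\<close>
      moreover have "real (s n) * real n - (real (r n))\<^sup>2
          = real n * (f_s n - 2 * \<alpha> * f_r n) - (f_r n)\<^sup>2"
        unfolding assms(5,6) by (simp add: power2_eq_square algebra_simps)
      ultimately have "\<bar>real (s n) / real (r n) - real (r n - s n) / real (n - r n)\<bar>
          = \<bar>real n * (f_s n - 2 * \<alpha> * f_r n) - (f_r n)\<^sup>2\<bar> / (real (r n) * real (n - r n))"
        by (simp add: abs_mult)
      also have "\<dots> \<le> (2 * (real n * Mx)) / (\<kappa> * (real n * real n))"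
      proof (rule frac_le)
        have "\<bar>real n * (f_s n - 2 * \<alpha> * f_r n) - (f_r n)\<^sup>2\<bar>
            \<le> real n * \<bar>f_s n - 2 * \<alpha> * f_r n\<bar> + real n * ((f_r n)\<^sup>2 / real n)"
          using n abs_triangle_ineq4[of "real n * (f_s n - 2 * \<alpha> * f_r n)" "(f_r n)\<^sup>2"]
          by (simp add: abs_mult)
        also have "\<dots> \<le> real n * Mx + real n * Mx"
          using n by (intro add_mono mult_left_mono) (auto simp: Mx_def)
        finally show "\<bar>real n * (f_s n - 2 * \<alpha> * f_r n) - (f_r n)\<^sup>2\<bar> \<le> 2 * (real n * Mx)"
          by (simp only: mult_2)
        have "((\<alpha> - e) * real n) * ((1 - \<alpha> - e) * real n) \<le> real (r n) * real (n - r n)"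
          using r(1) nr n e3 e0 by (intro mult_mono) auto
        then show "\<kappa> * (real n * real n) \<le> real (r n) * real (n - r n)"
          by (simp add: \<kappa>_def mult_ac)
      qed (use n \<kappa> in \<open>auto simp: Mx_def\<close>)
      also have "\<dots> = 2 / \<kappa> * (Mx / real n)" using n \<kappa> by (simp add: field_simps)
      finally have 1: "\<bar>real (s n) / real (r n) - real (r n - s n) / real (n - r n)\<bar>
          \<le> 2 / \<kappa> * (Mx / real n)" .
      \<comment> \<open>The drift is of order \<open>1 / n\<close>; the entry 1 in the maximum
        \<open>Mx\<close> absorbs it.\<close>
      have "2 / (e * real m) \<le> 2 / (e * (e * real n / 2))"
        using e0 n m by (intro divide_left_mono mult_left_mono mult_pos_pos) auto
      also have "\<dots> = 4 / e\<^sup>2 * (1 / real n)" using e0 n by (simp add: field_simps power2_eq_square)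
      also have "\<dots> \<le> 4 / e\<^sup>2 * (Mx / real n)"
        using n by (intro mult_left_mono divide_right_mono) (auto simp: Mx_def)
      finally have 2: "2 / (e * real m) \<le> 4 / e\<^sup>2 * (Mx / real n)" .
      show "\<bar>real (s n) / real (r n) - real (r n - s n) / real (n - r n)\<bar> + 2 / (e * m)
          \<le> (2 / \<kappa> + 4 / e\<^sup>2) * (Mx / real n)"
        unfolding distrib_right by (rule add_mono[OF 1 2])
    qed (simp add: D_def)
    also have "\<dots> = (2 / \<kappa> + 4 / e\<^sup>2) * (Mx / real n * D)" by (simp only: mult.assoc)
    also have "Mx / real n * D = norm (Mx / real n * D)"
      using n by (simp add: Mx_def D_def abs_mult)
    finally show ?case unfolding deg Mx_def by simp
  qed
  then show ?thesis by (rule bigoI)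
qed

end
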